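(* Let $d\ge0$ and consider the Gaussian broadcast model on the infinite model $P=\mathcal{HS}_{d+1}$ with parameter $\alpha:=\alpha_{d+1}>0$. (a) If $\alpha>\frac1{d+1}$, then single-vertex reconstruction is possible. (b) If $\alpha<\frac1{d+1}$, then local reconstruction is not possible. (c) If $\alpha=\frac1{d+1}$, then single-vertex reconstruction is possible when $d\ge3$, and local reconstruction is not possible when $d\in\{0,1,2\}$.
   Context: Gaussian broadcast model: Let $d\ge 0$ and let $P$ be an infinite graded poset with layers $L_0,L_1,\dots$ ($L_t$ = elements of rank $t$, $L_0$ = minimal elements), in which every element covers at most $d+1$ elements. For $v\in P$ let $\mathfrak p(v)$ be the set of elements covered by $v$. Given $\alpha_1,\dots,\alpha_{d+1}>0$, let $X_0\sim\mathcal N(0,1)$ and, independently, let $W_{u\to v}$ be i.i.d. $\mathcal N(0,1)$ indexed by covering pairs $u\lessdot v$. Set $X_v=X_0$ for $v\in L_0$, and for $v$ of rank $\ge1$ set $X_v=\alpha_{|\mathfrak p(v)|}\sum_{u\in\mathfrak p(v)}(X_u+W_{u\to v})$. Infinite model: $\mathcal{HS}_{d+1}=\{(x_1,\dots,x_{d+1})\in\mathbb Z^{d+1}: x_1+\dots+x_{d+1}\ge0\}$ with $u\le v$ iff $v-u\in\mathbb Z_{\ge0}^{d+1}$; $L_t$ is the set of points with coordinate sum $t$ (so every point of $L_0$ carries $X_0$); every element of rank $\ge1$ covers exactly the $d+1$ points $v-e_i$, so only $\alpha_{d+1}$ matters. A window of width $N$ is a set of the form $\big([x_1,x_1+N)\times\cdots\times[x_{d+1},x_{d+1}+N)\big)\cap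 P$ with $x_i\in\mathbb Z$. Local reconstruction is possible if there exist a finite $N$, windows $\mathcal W_t$ ($t\ge0$) of width $N$, and $c:P\to\mathbb R$ with $c|_{L_t}$ supported on $\mathcal W_t$, such that $\zeta_t:=\sum_{u\in L_t}c_uX_u$ satisfies $\operatorname{Var}(\zeta_t)>0$ for all $t$ and $\operatorname{corr}(\zeta_t,X_0)=\operatorname{Cov}(\zeta_t,X_0)/\sqrt{\operatorname{Var}(\zeta_t)\operatorname{Var}(X_0)}$ does not converge to $0$ as $t\to\infty$. Single-vertex reconstruction is possible if this can be done with $N=1$. *)

theory Defs
  imports "HOL-Probability.Probability"
begin

text \<open>Points of Z^(d+1) are represented as functions nat => int vanishing outside {0..d}.\<close>

type_synonym pt = "nat \<Rightarrow> int"

definition coord_sum :: "nat \<Rightarrow> pt \<Rightarrow> int" where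
  "coord_sum d x = (\<Sum>i\<le>d. x i)"

definition HS :: "nat \<Rightarrow> pt set" where
  "HS d = {x. (\<forall>i>d. x i = 0) \<and> coord_sum d x \<ge> 0}"

definition layer :: "nat \<Rightarrow> nat \<Rightarrow> pt set" where
  "layer d t = {x \<in> HS d. coord_sum d x = int t}"

definition unit_vec :: "nat \<Rightarrow> pt" where
  "unit_vec i = (\<lambda>j. if j = i then 1 else 0)"

text \<open>Covering pairs (v - e_i) covered-by v, indexed by (v, i): v of rank >= 1, i <= d.\<close>
definition edges :: "nat \<Rightarrow> (pt \<times> nat) set" where
  "edges d = {(v, i). v \<in> HS d \<and> coord_sum d v \<ge> 1 \<and> i \<le> d}"

text \<open>The Gaussian broadcast model on HS_(d+1) with parameter alpha = alpha_(d+1).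
  X0 is the root variable, W (v,i) is the noise on the edge v - e_i -> v, X v is the value at v.\<close>
definition gaussian_broadcast_HS ::
  "nat \<Rightarrow> real \<Rightarrow> 'a measure \<Rightarrow> ('a \<Rightarrow> real) \<Rightarrow> (pt \<times> nat \<Rightarrow> 'a \<Rightarrow> real)
     \<Rightarrow> (pt \<Rightarrow> 'a \<Rightarrow> real) \<Rightarrow> bool" where
  "gaussian_broadcast_HS d \<alpha> M X0 W X \<longleftrightarrow>
     prob_space M \<and>
     distributed M lborel X0 std_normal_density \<and>
     (\<forall>e \<in> edges d. distributed M lborel (W e) std_normal_density) \<and>
     prob_space.indep_vars M (\<lambda>_. borel)
        (\<lambda>j. case j of None \<Rightarrow> X0 | Some e \<Rightarrow> W e) (insert None (Some ` edges d)) \<and>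
     (\<forall>v \<in> layer d 0. X v = X0) \<and>
     (\<forall>t\<ge>1. \<forall>v \<in> layer d t.
        X v = (\<lambda>\<omega>. \<alpha> * (\<Sum>i\<le>d. X (v - unit_vec i) \<omega> + W (v, i) \<omega>)))"

definition covariance :: "'a measure \<Rightarrow> ('a \<Rightarrow> real) \<Rightarrow> ('a \<Rightarrow> real) \<Rightarrow> real" where
  "covariance M Y Z =
     prob_space.expectation M (\<lambda>\<omega>. (Y \<omega> - prob_space.expectation M Y) * (Z \<omega> - prob_space.expectation M Z))"

definition correlation :: "'a measure \<Rightarrow> ('a \<Rightarrow> real) \<Rightarrow> ('a \<Rightarrow> real) \<Rightarrow> real" where
  "correlation M Y Z =
     covariance M Y Z / sqrt (prob_space.variance M Y * prob_space.variance M Z)"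

definition window :: "nat \<Rightarrow> nat \<Rightarrow> pt \<Rightarrow> pt set" where
  "window d N a = {x \<in> HS d. \<forall>i\<le>d. a i \<le> x i \<and> x i < a i + int N}"

definition recon_with_width ::
  "nat \<Rightarrow> nat \<Rightarrow> 'a measure \<Rightarrow> ('a \<Rightarrow> real) \<Rightarrow> (pt \<Rightarrow> 'a \<Rightarrow> real) \<Rightarrow> bool" where
  "recon_with_width d N M X0 X \<longleftrightarrow>
     (\<exists>a :: nat \<Rightarrow> pt. \<exists>c :: pt \<Rightarrow> real.
        (\<forall>t. \<forall>u \<in> layer d t. c u \<noteq> 0 \<longrightarrow> u \<in> window d N (a t)) \<and>
        (let \<zeta> = (\<lambda>t \<omega>. \<Sum>u \<in> layer d t \<inter> window d N (a t). c u * X u \<omega>) in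
          (\<forall>t. prob_space.variance M (\<zeta> t) > 0) \<and>
          \<not> ((\<lambda>t. correlation M (\<zeta> t) X0) \<longlonglongrightarrow> 0)))"

definition local_reconstruction ::
  "nat \<Rightarrow> 'a measure \<Rightarrow> ('a \<Rightarrow> real) \<Rightarrow> (pt \<Rightarrow> 'a \<Rightarrow> real) \<Rightarrow> bool" where
  "local_reconstruction d M X0 X \<longleftrightarrow> (\<exists>N. recon_with_width d N M X0 X)"

definition single_vertex_reconstruction ::
  "nat \<Rightarrow> 'a measure \<Rightarrow> ('a \<Rightarrow> real) \<Rightarrow> (pt \<Rightarrow> 'a \<Rightarrow> real) \<Rightarrow> bool" where
  "single_vertex_reconstruction d M X0 X \<longleftrightarrow> recon_with_width d 1 M X0 X"

end

(* With \<beta> = \<alpha> (d + 1), a finite linear statistic with coefficients f on layer t has covariance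
   \<beta>^t (sum f) with the root and variance
     \<beta>^(2t) (sum f)^2 + \<alpha>^2 (d + 1) (sum over k < t of \<beta>^(2k) |A^k f|^2),
   where A averages over the d + 1 upward unit steps and |.| is the l2 norm: pulling the statistic
   back one layer replaces f by \<beta> A f and adds fresh uncorrelated noise. Reconstruction is thus a
   question about the decay of |A^k f|. For a point mass it is at most 1, and its square is of order
   k^(-d/2), so that the sum converges at \<beta> = 1 iff d >= 3. For d <= 2 and coefficients in a window
   of bounded width, a correlation bounded below makes the l1 norm of f comparable to |sum f|;
   Chebyshev's inequality then forces |A^k f|^2 to be at least a constant times (sum f)^2 / (k + 1). *)
theory Submission
  imports Defs "HOL-Library.Function_Algebras" "HOL-Library.Groups_Big_Fun" "HOL-Real_Asymp.Real_Asymp"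
begin

section \<open>Averaging over upward unit steps\<close>

text \<open>\<open>avg\<close> reads \<open>f\<close> at \<open>w + unit_vec i\<close>, so it moves
  mass down: for a probability vector \<open>f\<close>, \<open>(avg d ^^ k) f\<close> is the law
  after \<open>k\<close> steps of the walk that subtracts a uniformly chosen unit vector. The upper
  bound for a point mass rests on the multinomial form of this law and not on a local limit theorem:
  when d + 1 divides \<open>k\<close>, no value exceeds the one for equal counts; the ratio of
  consecutive central values is at most an explicit exponential, and these ratios telescope into a
  power of \<open>k\<close>. The squared norm is at most the maximum times the total mass. The
  obstacle to the lower bound is cancellation: for signed coefficients, such as a perturbed discrete
  derivative, |A^k f| can be far smaller than the l1 norm suggests. The variance formula supplies
  the remedy itself. Its k = 0 term is a multiple of |f|^2, which on a window of bounded size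
  controls the l1 norm, so a correlation bounded below limits the cancellation. Second moments are
  taken for A^k applied to the absolute values of \<open>f\<close>, which dominates A^k f
  pointwise.\<close>

definition avg :: "nat \<Rightarrow> (pt \<Rightarrow> real) \<Rightarrow> pt \<Rightarrow> real" where
  "avg d f w = (\<Sum>i\<le>d. f (w + unit_vec i)) / real (d + 1)"

abbreviation finsupp :: "(pt \<Rightarrow> real) \<Rightarrow> bool" where
  "finsupp f \<equiv> finite {w. f w \<noteq> 0}"

text \<open>\<open>Sum_any\<close> ranges over the whole infinite type and is 0 by default on
  infinite support, so statements about it carry \<open>finsupp\<close>; in return the sums are not
  tied to a layer.\<close>

definition l2sq :: "(pt \<Rightarrow> real) \<Rightarrow> real" where
  "l2sq f = Sum_any (\<lambda>w. (f w)\<^sup>2)"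

lemma Sum_any_finsupp:
  assumes "finsupp f" "\<And>w. f w = 0 \<Longrightarrow> g w = (0::real)"
  shows "Sum_any g = sum g {w. f w \<noteq> 0}"
  by (rule Sum_any.expand_superset[OF assms(1)]) (use assms(2) in auto)

lemma supp_avg: "{w. avg d f w \<noteq> 0} \<subseteq> (\<Union>i\<le>d. (\<lambda>w. w - unit_vec i) ` {w. f w \<noteq> 0})"
proof
  fix w assume "w \<in> {w. avg d f w \<noteq> 0}"
  then have "(\<Sum>i\<le>d. f (w + unit_vec i)) \<noteq> 0"
    by (auto simp: avg_def)
  then obtain i where "i \<le> d" "f (w + unit_vec i) \<noteq> 0"
    by (meson atMost_iff sum.neutral)
  moreover have "w = (w + unit_vec i) - unit_vec i"
    by simp
  ultimately show "w \<in> (\<Union>i\<le>d. (\<lambda>w. w - unit_vec i) ` {w. f w \<noteq> 0})"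
    by blast
qed

lemma finsupp_avg: "finsupp f \<Longrightarrow> finsupp (avg d f)"
  by (rule finite_subset[OF supp_avg]) auto

lemma finsupp_avg_pow: "finsupp f \<Longrightarrow> finsupp ((avg d ^^ k) f)"
  by (induction k) (auto intro: finsupp_avg)

text \<open>The adjoint of \<open>avg\<close> averages over downward steps. \<open>g\<close> is
  arbitrary: the constant 1 gives conservation of mass, \<open>spread\<close> gives the second
  moment recursion, and the field \<open>X\<close> at a fixed outcome gives the pull-back by one
  layer.\<close>

lemma Sum_any_avg_mult:
  assumes "finsupp f"
  shows "Sum_any (\<lambda>w. avg d f w * g w)
       = Sum_any (\<lambda>w. f w * ((\<Sum>i\<le>d. g (w - unit_vec i)) / real (d + 1)))"
proof -
  let ?A = "{w. f w \<noteq> 0}"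
  \<comment> \<open>Contains every shifted support at once, so that the sums over \<open>i\<close>
    and \<open>w\<close> can be exchanged over a fixed index set.\<close>
  define B where "B = (\<Union>i\<le>d. (\<lambda>w. w - unit_vec i) ` ?A)"
  have fB: "finite B"
    using assms by (auto simp: B_def)
  have shift: "(\<Sum>w\<in>B. f (w + unit_vec i) * g w) = (\<Sum>w\<in>?A. f w * g (w - unit_vec i))"
    if "i \<le> d" for i
  proof -
    have "(\<Sum>w\<in>?A. f w * g (w - unit_vec i))
        = (\<Sum>w\<in>(\<lambda>w. w - unit_vec i) ` ?A. f (w + unit_vec i) * g w)"
      by (subst sum.reindex) (auto simp: inj_on_def)
    also have "\<dots> = (\<Sum>w\<in>B. f (w + unit_vec i) * g w)"
    proof (rule sum.mono_neutral_left[OF fB])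
      show "(\<lambda>w. w - unit_vec i) ` ?A \<subseteq> B"
        using that by (auto simp: B_def)
      show "\<forall>w\<in>B - (\<lambda>w. w - unit_vec i) ` ?A. f (w + unit_vec i) * g w = 0"
      proof
        fix w assume w: "w \<in> B - (\<lambda>w. w - unit_vec i) ` ?A"
        have "w = (w + unit_vec i) - unit_vec i"
          by simp
        with w have "f (w + unit_vec i) = 0"
          by blast
        then show "f (w + unit_vec i) * g w = 0"
          by simp
      qed
    qed
    finally show ?thesis ..
  qed
  have "Sum_any (\<lambda>w. avg d f w * g w) = (\<Sum>w\<in>B. avg d f w * g w)"
    by (rule Sum_any.expand_superset[OF fB]) (use supp_avg[of d f] in \<open>auto simp: B_def\<close>)
  also have "\<dots> = (\<Sum>w\<in>B. \<Sum>i\<le>d. f (w + unit_vec i) * g w) / real (d + 1)"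
    by (simp add: avg_def sum_divide_distrib sum_distrib_right)
  also have "\<dots> = (\<Sum>i\<le>d. \<Sum>w\<in>B. f (w + unit_vec i) * g w) / real (d + 1)"
    by (subst sum.swap) simp
  also have "\<dots> = (\<Sum>i\<le>d. \<Sum>w\<in>?A. f w * g (w - unit_vec i)) / real (d + 1)"
    using shift by simp
  also have "\<dots> = (\<Sum>w\<in>?A. f w * ((\<Sum>i\<le>d. g (w - unit_vec i)) / real (d + 1)))"
    by (subst sum.swap) (simp add: sum_divide_distrib sum_distrib_left)
  also have "\<dots> = Sum_any (\<lambda>w. f w * ((\<Sum>i\<le>d. g (w - unit_vec i)) / real (d + 1)))"
    by (rule Sum_any_finsupp[OF assms, symmetric]) auto
  finally show ?thesis .
qed

lemma Sum_any_avg: "finsupp f \<Longrightarrow> Sum_any (avg d f) = Sum_any f"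
  using Sum_any_avg_mult[of f d "\<lambda>_. 1"] by (simp add: add.commute)

lemma Sum_any_avg_pow: "finsupp f \<Longrightarrow> Sum_any ((avg d ^^ k) f) = Sum_any f"
  by (induction k) (simp_all add: Sum_any_avg finsupp_avg_pow)

lemma avg_mono: "(\<And>w. f w \<le> g w) \<Longrightarrow> avg d f w \<le> avg d g w"
  by (auto simp: avg_def intro!: divide_right_mono sum_mono)

lemma avg_const: "avg d (\<lambda>_. c) w = c"
  by (simp add: avg_def field_simps)

lemma avg_nonneg: "(\<And>w. 0 \<le> f w) \<Longrightarrow> 0 \<le> avg d f w"
  by (auto simp: avg_def intro!: divide_nonneg_nonneg sum_nonneg)

lemma avg_pow_nonneg: "(\<And>w. 0 \<le> f w) \<Longrightarrow> 0 \<le> (avg d ^^ k) f w"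
  by (induction k arbitrary: w) (auto intro: avg_nonneg)

lemma abs_avg_le: "\<bar>avg d f w\<bar> \<le> avg d (\<lambda>w. \<bar>f w\<bar>) w"
  by (auto simp: avg_def intro!: divide_right_mono sum_abs)

lemma abs_avg_pow_le: "\<bar>(avg d ^^ k) f w\<bar> \<le> (avg d ^^ k) (\<lambda>w. \<bar>f w\<bar>) w"
proof (induction k arbitrary: w)
  case (Suc k)
  have "\<bar>avg d ((avg d ^^ k) f) w\<bar> \<le> avg d (\<lambda>w. \<bar>(avg d ^^ k) f w\<bar>) w"
    by (rule abs_avg_le)
  also have "\<dots> \<le> avg d ((avg d ^^ k) (\<lambda>w. \<bar>f w\<bar>)) w"
    by (rule avg_mono) (rule Suc)
  finally show ?case
    by simp
qed simp

lemma layer_minus_unit_vec: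
  assumes "u \<in> layer d (Suc t)" "i \<le> d"
  shows "u - unit_vec i \<in> layer d t"
proof -
  have "coord_sum d (u - unit_vec i) = coord_sum d u - 1"
    using assms(2) by (simp add: coord_sum_def unit_vec_def sum_subtractf)
  then show ?thesis
    using assms by (auto simp: layer_def HS_def unit_vec_def)
qed

lemma supp_avg_layer:
  assumes "{w. f w \<noteq> 0} \<subseteq> layer d (Suc t)"
  shows "{w. avg d f w \<noteq> 0} \<subseteq> layer d t"
  using supp_avg[of d f] layer_minus_unit_vec[of _ d t] assms by fastforce

lemma supp_avg_pow_layer:
  assumes "{w. f w \<noteq> 0} \<subseteq> layer d t" "k \<le> t"
  shows "{w. (avg d ^^ k) f w \<noteq> 0} \<subseteq> layer d (t - k)"
  using assms(2)
proof (induction k)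
  case (Suc k)
  then have "{w. (avg d ^^ k) f w \<noteq> 0} \<subseteq> layer d (Suc (t - Suc k))"
    by (simp add: Suc_diff_Suc)
  then show ?case
    using supp_avg_layer by simp
qed (use assms in simp)

lemma l2sq_nonneg: "finsupp f \<Longrightarrow> 0 \<le> l2sq f"
  unfolding l2sq_def by (subst Sum_any_finsupp[of f]) (auto intro: sum_nonneg)

section \<open>Second moment about the drifting centre a - k/(d+1) (1,...,1)\<close>

definition spread :: "nat \<Rightarrow> pt \<Rightarrow> nat \<Rightarrow> pt \<Rightarrow> real" where
  "spread d a k w = (\<Sum>j\<le>d. (of_int (w j) - of_int (a j) + real k / real (d + 1))\<^sup>2)"

lemma spread_nonneg: "0 \<le> spread d a k w"
  by (auto simp: spread_def intro: sum_nonneg)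

text \<open>A unit step minus its mean is centred, so the cross terms cancel and only its variance
  is added, which is 1 - 1/(d+1) over all coordinates together; the bound rounds it up to 1.\<close>

lemma mean_spread_le:
  "(\<Sum>i\<le>d. spread d a (Suc k) (w - unit_vec i)) / real (d + 1) \<le> spread d a k w + 1"
proof -
  define n where "n = real (d + 1)"
  define y where "y j = real_of_int (w j) - of_int (a j) + real k / n" for j
  have n: "n \<ge> 1"
    by (simp add: n_def)
  have inner: "(\<Sum>i\<le>d. (y j + 1 / n - (if j = i then 1 else 0))\<^sup>2) = n * (y j)\<^sup>2 + (1 - 1 / n)"
    if "j \<le> d" for j
  proof -
    have "(\<Sum>i\<le>d. (y j + 1 / n - (if j = i then 1 else 0))\<^sup>2)
        = (\<Sum>i\<le>d. (y j + 1 / n)\<^sup>2 + (if j = i then 1 - 2 * (y j + 1 / n) else 0))"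
      by (intro sum.cong refl) (auto simp: power2_eq_square algebra_simps)
    also have "\<dots> = n * (y j + 1 / n)\<^sup>2 + (1 - 2 * (y j + 1 / n))"
      using that by (simp add: sum.distrib n_def)
    also have "\<dots> = n * (y j)\<^sup>2 + (1 - 1 / n)"
      using n by (simp add: power2_eq_square field_simps)
    finally show ?thesis .
  qed
  have "(\<Sum>i\<le>d. spread d a (Suc k) (w - unit_vec i))
      = (\<Sum>i\<le>d. \<Sum>j\<le>d. (y j + 1 / n - (if j = i then 1 else 0))\<^sup>2)"
    unfolding spread_def y_def n_def unit_vec_def
    by (intro sum.cong refl arg_cong[where f = "\<lambda>x. x\<^sup>2"])
       (auto simp: field_simps)
  also have "\<dots> = (\<Sum>j\<le>d. \<Sum>i\<le>d. (y j + 1 / n - (if j = i then 1 else 0))\<^sup>2)"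
    by (rule sum.swap)
  also have "\<dots> = n * (\<Sum>j\<le>d. (y j)\<^sup>2) + (n - 1)"
  proof -
    have "(\<Sum>j\<le>d. \<Sum>i\<le>d. (y j + 1 / n - (if j = i then 1 else 0))\<^sup>2)
        = (\<Sum>j\<le>d. n * (y j)\<^sup>2 + (1 - 1 / n))"
      by (intro sum.cong refl inner) auto
    also have "\<dots> = n * (\<Sum>j\<le>d. (y j)\<^sup>2) + n * (1 - 1 / n)"
      by (simp add: sum.distrib sum_distrib_left n_def)
    moreover have "n * (1 - 1 / n) = n - 1"
      using n by (simp add: field_simps)
    ultimately show ?thesis
      by simp
  qed
  also have "(\<Sum>j\<le>d. (y j)\<^sup>2) = spread d a k w"
    by (simp add: spread_def y_def n_def)
  finally have eq: "(\<Sum>i\<le>d. spread d a (Suc k) (w - unit_vec i)) = n * spread d a k w + (n - 1)" .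
  show ?thesis
    using n unfolding eq n_def[symmetric] by (simp add: field_simps)
qed

text \<open>Adjointness moves each average from the mass onto \<open>spread\<close>, where it costs
  at most the total mass. Nonnegativity of \<open>f\<close> lets the pointwise bound be summed,
  which is why the lemma is later applied to absolute values.\<close>

lemma Sum_any_spread_le:
  assumes "finsupp f" "\<And>w. 0 \<le> f w"
  shows "Sum_any (\<lambda>w. (avg d ^^ k) f w * spread d a k w)
       \<le> Sum_any (\<lambda>w. f w * spread d a 0 w) + real k * Sum_any f"
proof (induction k)
  case (Suc k)
  let ?g = "(avg d ^^ k) f"
  have fg: "finsupp ?g"
    by (rule finsupp_avg_pow) fact
  have "Sum_any (\<lambda>w. avg d ?g w * spread d a (Suc k) w)
      = (\<Sum>w | ?g w \<noteq> 0. ?g w * ((\<Sum>i\<le>d. spread d a (Suc k) (w - unit_vec i)) / real (d + 1)))"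
    unfolding Sum_any_avg_mult[OF fg] by (rule Sum_any_finsupp[OF fg]) auto
  also have "\<dots> \<le> (\<Sum>w | ?g w \<noteq> 0. ?g w * (spread d a k w + 1))"
    by (intro sum_mono mult_left_mono mean_spread_le avg_pow_nonneg assms)
  also have "\<dots> = (\<Sum>w | ?g w \<noteq> 0. ?g w * spread d a k w) + (\<Sum>w | ?g w \<noteq> 0. ?g w)"
    by (simp add: algebra_simps sum.distrib)
  also have "(\<Sum>w | ?g w \<noteq> 0. ?g w * spread d a k w) = Sum_any (\<lambda>w. ?g w * spread d a k w)"
    by (rule Sum_any_finsupp[OF fg, symmetric]) auto
  also have "(\<Sum>w | ?g w \<noteq> 0. ?g w) = Sum_any f"
    using Sum_any_avg_pow[OF assms(1)] by (simp add: Sum_any.expand_set)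
  finally show ?case
    using Suc by (simp add: algebra_simps)
qed simp

section \<open>Lattice points of a layer in a box\<close>

lemma card_int_interval_le:
  assumes "0 \<le> r"
  shows "finite {i::int. \<bar>of_int i - z\<bar> \<le> r}" "real (card {i::int. \<bar>of_int i - z\<bar> \<le> r}) \<le> 2 * r + 1"
proof -
  have eq: "{i::int. \<bar>of_int i - z\<bar> \<le> r} = {\<lceil>z - r\<rceil>..\<lfloor>z + r\<rfloor>}"
    by (auto simp: abs_le_iff ceiling_le_iff le_floor_iff)
  show "finite {i::int. \<bar>of_int i - z\<bar> \<le> r}"
    by (simp add: eq)
  show "real (card {i::int. \<bar>of_int i - z\<bar> \<le> r}) \<le> 2 * r + 1"
    using assms unfolding eq by simp linarith
qed

text \<open>The exponent is \<open>d\<close> and not \<open>d + 1\<close> because the last coordinate is determined by the layer.\<close>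
lemma card_layer_box_le:
  fixes z :: "nat \<Rightarrow> real"
  assumes "0 \<le> r"
  shows "finite {w \<in> layer d t. \<forall>j\<le>d. \<bar>of_int (w j) - z j\<bar> \<le> r}"
    and "real (card {w \<in> layer d t. \<forall>j\<le>d. \<bar>of_int (w j) - z j\<bar> \<le> r}) \<le> (2 * r + 1) ^ d"
proof -
  let ?B = "{w \<in> layer d t. \<forall>j\<le>d. \<bar>of_int (w j) - z j\<bar> \<le> r}"
  let ?I = "\<lambda>j. {i::int. \<bar>of_int i - z j\<bar> \<le> r}"
  let ?P = "Pi\<^sub>E {..<d} ?I"
  have sub: "(\<lambda>w. restrict w {..<d}) ` ?B \<subseteq> ?P"
    by (auto simp: PiE_iff extensional_def split: if_splits)
  have inj: "inj_on (\<lambda>w. restrict w {..<d}) ?B"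
  proof (rule inj_onI)
    fix v w assume v: "v \<in> ?B" and w: "w \<in> ?B" and eq: "restrict v {..<d} = restrict w {..<d}"
    have less: "v j = w j" if "j < d" for j
      using fun_cong[OF eq, of j] that by simp
    have "(\<Sum>j<d. v j) + v d = (\<Sum>j<d. w j) + w d"
      using v w by (simp add: layer_def coord_sum_def lessThan_Suc_atMost[symmetric])
    then have "v d = w d"
      using less by simp
    moreover have "v j = w j" if "j > d" for j
      using v w that by (simp add: layer_def HS_def)
    ultimately show "v = w"
      using less by (metis ext linorder_neqE_nat)
  qed
  have fin: "finite ?P"
    using card_int_interval_le(1)[OF assms] by (intro finite_PiE) auto
  show "finite ?B"
    using finite_imageD[OF finite_subset[OF sub fin] inj] .
  have "real (card ?B) \<le> real (card ?P)"
    using card_inj_on_le[OF inj sub fin] by simp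
  also have "\<dots> = (\<Prod>j<d. real (card (?I j)))"
    by (simp add: card_PiE)
  also have "\<dots> \<le> (\<Prod>j<d. 2 * r + 1)"
    by (intro prod_mono) (use card_int_interval_le(2)[OF assms] in auto)
  finally show "real (card ?B) \<le> (2 * r + 1) ^ d"
    by simp
qed

section \<open>Decay of the averages of a point mass\<close>

definition delta :: "pt \<Rightarrow> pt \<Rightarrow> real" where
  "delta v w = (if w = v then 1 else 0)"

lemma finsupp_delta: "finsupp (delta v)"
  by (rule finite_subset[of _ "{v}"]) (auto simp: delta_def)

lemma Sum_any_delta: "Sum_any (delta v) = 1"
  by (subst Sum_any.expand_superset[of "{v}"]) (auto simp: delta_def)

lemma delta_nonneg: "0 \<le> delta v w"
  by (simp add: delta_def)

lemma avg_pow_le: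
  assumes "\<And>w. f w \<le> K"
  shows "(avg d ^^ k) f w \<le> K"
proof (induction k arbitrary: w)
  case (Suc k)
  then have "avg d ((avg d ^^ k) f) w \<le> avg d (\<lambda>_. K) w"
    by (intro avg_mono)
  then show ?case
    by (simp add: avg_const)
qed (use assms in simp)

lemma l2sq_le:
  assumes "finsupp f" "\<And>w. 0 \<le> f w" "\<And>w. f w \<le> K"
  shows "l2sq f \<le> K * Sum_any f"
proof -
  have "l2sq f = (\<Sum>w | f w \<noteq> 0. (f w)\<^sup>2)"
    unfolding l2sq_def by (rule Sum_any_finsupp) (use assms in auto)
  also have "\<dots> \<le> (\<Sum>w | f w \<noteq> 0. K * f w)"
    using assms by (intro sum_mono) (auto simp: power2_eq_square intro: mult_right_mono)
  also have "\<dots> = K * Sum_any f"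
    by (simp add: sum_distrib_left Sum_any.expand_set)
  finally show ?thesis .
qed

section \<open>Multinomial form of the averages of a point mass\<close>

lemma supp_avg_pow_delta:
  assumes "(avg d ^^ k) (delta v) w \<noteq> 0"
  shows "(\<forall>i\<le>d. w i \<le> v i) \<and> (\<Sum>i\<le>d. v i - w i) = int k"
  using assms
proof (induction k arbitrary: w)
  case 0
  then show ?case
    by (auto simp: delta_def split: if_splits)
next
  case (Suc k)
  from Suc.prems have "(\<Sum>i\<le>d. (avg d ^^ k) (delta v) (w + unit_vec i)) \<noteq> 0"
    by (simp add: avg_def[of d "(avg d ^^ k) (delta v)"])
  then obtain i where i: "i \<le> d" "(avg d ^^ k) (delta v) (w + unit_vec i) \<noteq> 0"
    by (meson atMost_iff sum.neutral)
  have le: "\<forall>j\<le>d. w j + unit_vec i j \<le> v j" and sm: "(\<Sum>j\<le>d. v j - (w j + unit_vec i j)) = int k"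
    using Suc.IH[OF i(2)] by (auto simp: plus_fun_def)
  have "w j \<le> v j" if "j \<le> d" for j
    using le that by (auto simp: unit_vec_def split: if_splits dest!: spec[of _ j])
  moreover have "(\<Sum>j\<le>d. v j - (w j + unit_vec i j)) = (\<Sum>j\<le>d. v j - w j) - 1"
    using i(1) by (simp add: sum_subtractf sum.distrib unit_vec_def)
  ultimately show ?case
    using sm by simp
qed

text \<open>With y = v - w this is the multinomial probability of the counts y, multiplied out to
  avoid division. In the induction the step in direction i contributes the factor y_i, and these
  factors sum to k + 1.\<close>

lemma avg_pow_delta_multinomial:
  assumes "\<forall>i\<le>d. w i \<le> v i" "(\<Sum>i\<le>d. v i - w i) = int k"
  shows "(avg d ^^ k) (delta v) w * (\<Prod>i\<le>d. fact (nat (v i - w i))) \<le> fact k / real (d + 1) ^ k"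
  using assms
proof (induction k arbitrary: w)
  case 0
  then have "\<forall>i\<in>{..d}. v i - w i = 0"
    using sum_nonneg_eq_0_iff[of "{..d}" "\<lambda>i. v i - w i"] by auto
  then show ?case
    by (simp add: delta_def)
next
  case (Suc k)
  let ?h = "(avg d ^^ k) (delta v)" and ?n = "real (d + 1)"
  let ?P = "\<lambda>w. \<Prod>i\<le>d. fact (nat (v i - w i)) :: real"
  have step: "?h (w + unit_vec i) * ?P w \<le> of_int (v i - w i) * (fact k / ?n ^ k)" if i: "i \<le> d" for i
  proof (cases "v i = w i")
    case True
    then have "\<not> (w + unit_vec i) i \<le> v i"
      by (simp add: unit_vec_def)
    then have "?h (w + unit_vec i) = 0"
      using supp_avg_pow_delta i by blast
    then show ?thesis
      using True by simp
  next
    case False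
    with Suc.prems i have less: "w i < v i"
      by (simp add: order_less_le)
    have le: "\<forall>j\<le>d. (w + unit_vec i) j \<le> v j"
      using Suc.prems less by (auto simp: plus_fun_def unit_vec_def)
    have sm: "(\<Sum>j\<le>d. v j - (w + unit_vec i) j) = int k"
      using Suc.prems i by (simp add: plus_fun_def sum_subtractf sum.distrib unit_vec_def)
    have Suc_eq: "nat (v i - w i) = Suc (nat (v i - (w + unit_vec i) i))"
      using less by (simp add: plus_fun_def unit_vec_def)
    have "?P w = fact (nat (v i - w i)) * (\<Prod>j\<in>{..d} - {i}. fact (nat (v j - w j)))"
      using i by (subst prod.remove[of _ i]) auto
    also have "(\<Prod>j\<in>{..d} - {i}. fact (nat (v j - w j)))
        = (\<Prod>j\<in>{..d} - {i}. fact (nat (v j - (w + unit_vec i) j)) :: real)"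
      by (intro prod.cong) (auto simp: plus_fun_def unit_vec_def)
    also have "fact (nat (v i - w i)) = of_int (v i - w i) * (fact (nat (v i - (w + unit_vec i) i)) :: real)"
      unfolding Suc_eq fact_Suc using less by (simp add: plus_fun_def unit_vec_def)
    also have "of_int (v i - w i) * fact (nat (v i - (w + unit_vec i) i))
          * (\<Prod>j\<in>{..d} - {i}. fact (nat (v j - (w + unit_vec i) j))) = of_int (v i - w i) * ?P (w + unit_vec i)"
      using i by (subst (2) prod.remove[of _ i]) auto
    finally have "?h (w + unit_vec i) * ?P w
        = of_int (v i - w i) * (?h (w + unit_vec i) * ?P (w + unit_vec i))"
      by simp
    also have "\<dots> \<le> of_int (v i - w i) * (fact k / ?n ^ k)"
      using less by (intro mult_left_mono[OF Suc.IH[OF le sm]]) simp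
    finally show ?thesis .
  qed
  have "(avg d ^^ Suc k) (delta v) w * ?P w = (\<Sum>i\<le>d. ?h (w + unit_vec i) * ?P w) / ?n"
    by (simp add: avg_def sum_distrib_right)
  also have "\<dots> \<le> (\<Sum>i\<le>d. of_int (v i - w i) * (fact k / ?n ^ k)) / ?n"
    by (intro divide_right_mono sum_mono step) auto
  also have "\<dots> = of_int (\<Sum>i\<le>d. v i - w i) * (fact k / ?n ^ k) / ?n"
    by (simp only: sum_distrib_right of_int_sum)
  also have "\<dots> = fact (Suc k) / ?n ^ Suc k"
    using Suc.prems by (simp add: field_simps)
  finally show ?case .
qed

text \<open>As a function of y, m^y / y! has ratio m / (y + 1) between neighbours, so it is largest
  at y = m; the two inductions move away from m upwards and downwards. Multiplied over coordinates
  with total (d + 1) m, the powers of m cancel, and equal counts are seen to minimise the product of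
  factorials.\<close>

lemma fact_mult_power_le:
  "fact m * real m ^ y \<le> fact y * real m ^ m"
proof (cases "m \<le> y")
  case True
  then show ?thesis
  proof (induction y rule: dec_induct)
    case (step y)
    have "fact m * real m ^ Suc y = real m * (fact m * real m ^ y)"
      by simp
    also have "\<dots> \<le> real (Suc y) * (fact y * real m ^ m)"
      using step.hyps by (intro mult_mono[OF _ step.IH]) auto
    finally show ?case
      by (simp add: algebra_simps)
  qed simp
next
  case False
  then have "y \<le> m"
    by simp
  then show ?thesis
  proof (induction y rule: inc_induct)
    case (step y)
    have "real m * (fact m * real m ^ y) \<le> real (Suc y) * (fact y * real m ^ m)"
      using step.IH by (simp add: algebra_simps)
    also have "\<dots> \<le> real m * (fact y * real m ^ m)"
      using step.hyps by (intro mult_right_mono) auto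
    finally show ?case
      using step.hyps by simp
  qed simp
qed

text \<open>Probability that n * m independent uniform choices among n boxes put exactly m into
  each.\<close>

definition central_multinomial :: "nat \<Rightarrow> nat \<Rightarrow> real" where
  "central_multinomial n m = fact (n * m) / (fact m ^ n * real n ^ (n * m))"

lemma avg_pow_delta_le_central:
  "(avg d ^^ (Suc d * m)) (delta v) w \<le> central_multinomial (Suc d) m"
proof (cases "(avg d ^^ (Suc d * m)) (delta v) w = 0")
  case True
  then show ?thesis
    by (simp add: central_multinomial_def)
next
  case False
  define y where "y i = nat (v i - w i)" for i
  let ?h = "(avg d ^^ (Suc d * m)) (delta v) w"
  have supp: "\<forall>i\<le>d. w i \<le> v i" "(\<Sum>i\<le>d. v i - w i) = int (Suc d * m)"
    using supp_avg_pow_delta[OF False] by auto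
  have "int (\<Sum>i\<le>d. y i) = (\<Sum>i\<le>d. v i - w i)"
    using supp(1) unfolding of_nat_sum by (intro sum.cong) (auto simp: y_def)
  then have sum_y: "(\<Sum>i\<le>d. y i) = Suc d * m"
    using supp(2) by linarith
  have "(\<Prod>i\<le>d. fact m * real m ^ y i) \<le> (\<Prod>i\<le>d. fact (y i) * real m ^ m)"
    by (intro prod_mono) (auto intro: fact_mult_power_le)
  then have "fact m ^ Suc d * real m ^ (Suc d * m) \<le> (\<Prod>i\<le>d. fact (y i)) * real m ^ (Suc d * m)"
    by (simp add: prod.distrib power_sum[symmetric] sum_y power_mult[symmetric] mult.commute del: power_Suc)
  \<comment> \<open>For \<open>m = 0\<close> the exponent is 0 as well and the power is 1, so it can
    be cancelled in every case.\<close>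
  moreover have "real m ^ (Suc d * m) > 0"
    by (cases m) auto
  ultimately have ge: "fact m ^ Suc d \<le> (\<Prod>i\<le>d. fact (y i) :: real)"
    by (simp only: mult_le_cancel_right_pos)
  have "?h * fact m ^ Suc d \<le> ?h * (\<Prod>i\<le>d. fact (y i))"
    by (intro mult_left_mono ge avg_pow_nonneg delta_nonneg)
  also have "\<dots> \<le> fact (Suc d * m) / real (Suc d) ^ (Suc d * m)"
    using avg_pow_delta_multinomial[OF supp] by (simp only: y_def Suc_eq_plus1)
  finally show ?thesis
    unfolding central_multinomial_def
    by (simp add: field_simps del: power_Suc mult_Suc fact_Suc of_nat_Suc)
qed

section \<open>Power decay of the central multinomial probability\<close>

lemma fact_add_eq_prod: "fact (a + b) = fact a * (\<Prod>j<b. real (a + j + 1))"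
  by (induction b) (simp_all add: algebra_simps)

lemma sum_reflect_nat: "(\<Sum>j\<le>d. real d - real j) = real d * real (d + 1) / 2"
proof -
  have "(\<Sum>j\<le>d. real j) = real d * real (d + 1) / 2"
    by (induction d) (simp_all add: field_simps)
  then show ?thesis
    by (simp add: sum_subtractf algebra_simps)
qed

text \<open>The ratio of neighbouring values is the product over j of 1 - (d - j) / ((d + 1) (m +
  1)). Bounding each factor by an exponential and summing d - j to d (d + 1) / 2 leaves d / (2 (m +
  1)), the exponent behind the decay m^(-d/2); Stirling's formula is avoided.\<close>

lemma central_multinomial_Suc_le:
  "central_multinomial (Suc d) (Suc m)
    \<le> central_multinomial (Suc d) m * exp (- (real d / (2 * real (Suc m))))"
proof -
  let ?n = "Suc d"
  have factor: "real (?n * m + j + 1) / (real ?n * real (Suc m))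
      \<le> exp (- ((real d - real j) / (real ?n * real (Suc m))))" for j
  proof -
    have "real (?n * m + j + 1) / (real ?n * real (Suc m))
        = 1 + - ((real d - real j) / (real ?n * real (Suc m)))"
    proof -
      have "real (?n * m + j + 1) = real ?n * real (Suc m) - (real d - real j)"
        by (simp add: algebra_simps)
      then show ?thesis
        by (simp add: diff_divide_distrib del: of_nat_Suc)
    qed
    also have "\<dots> \<le> exp (- ((real d - real j) / (real ?n * real (Suc m))))"
      by (rule exp_ge_add_one_self)
    finally show ?thesis .
  qed
  have eq: "central_multinomial ?n (Suc m)
      = central_multinomial ?n m * ((\<Prod>j<?n. real (?n * m + j + 1)) / (real ?n * real (Suc m)) ^ ?n)"
  proof -
    have 1: "(fact (?n * Suc m) :: real) = fact (?n * m) * (\<Prod>j<?n. real (?n * m + j + 1))"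
      using fact_add_eq_prod[of "?n * m" ?n] by (simp add: add.commute del: fact_Suc)
    have 2: "(fact (Suc m) :: real) ^ ?n = real (Suc m) ^ ?n * fact m ^ ?n"
      by (simp add: power_mult_distrib del: power_Suc)
    have 3: "real ?n ^ (?n * Suc m) = real ?n ^ ?n * real ?n ^ (?n * m)"
      by (simp only: mult_Suc_right power_add)
    show ?thesis
      unfolding central_multinomial_def 1 2 3 power_mult_distrib by simp
  qed
  have "(\<Prod>j<?n. real (?n * m + j + 1)) / (real ?n * real (Suc m)) ^ ?n
      = (\<Prod>j\<le>d. real (?n * m + j + 1) / (real ?n * real (Suc m)))"
    unfolding lessThan_Suc_atMost prod_dividef by simp
  also have "\<dots> \<le> (\<Prod>j\<le>d. exp (- ((real d - real j) / (real ?n * real (Suc m)))))"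
    by (intro prod_mono conjI factor) auto
  also have "\<dots> = exp (- ((\<Sum>j\<le>d. real d - real j) / (real ?n * real (Suc m))))"
    by (simp only: exp_sum[symmetric] finite_atMost sum_negf sum_divide_distrib[symmetric])
  also have "\<dots> = exp (- (real d / (2 * real (Suc m))))"
  proof -
    have "x * n / 2 / (n * y) = x / (2 * y)" if "n \<noteq> 0" for x n y :: real
      using that by simp
    from this[of "real ?n" "real d" "real (Suc m)"] show ?thesis
      unfolding sum_reflect_nat by simp
  qed
  finally show ?thesis
    unfolding eq by (rule mult_left_mono) (simp add: central_multinomial_def)
qed

text \<open>The exponent 3/2 is d/2 at d = 3 and already summable, so larger \<open>d\<close> calls
  for nothing sharper. The step uses exp (- 1 / (m + 1)) \<le> (m + 1) / (m + 2), whose powers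
  telescope.\<close>

lemma central_multinomial_le:
  assumes "d \<ge> 3"
  shows "central_multinomial (Suc d) m \<le> real (Suc m) powr (- 3 / 2)"
proof (induction m)
  case (Suc m)
  have "real (Suc (Suc m)) / real (Suc m) \<le> exp (1 / real (Suc m))"
    using exp_ge_add_one_self[of "1 / real (Suc m)"] by (simp add: field_simps)
  then have "exp (- (1 / real (Suc m))) \<le> real (Suc m) / real (Suc (Suc m))"
    unfolding exp_minus by (simp add: field_simps)
  then have "exp (- (1 / real (Suc m))) powr (3 / 2) \<le> (real (Suc m) / real (Suc (Suc m))) powr (3 / 2)"
    by (intro powr_mono2) auto
  moreover have "exp (- (real d / (2 * real (Suc m)))) \<le> exp (- (1 / real (Suc m))) powr (3 / 2)"
  proof -
    have "3 / (2 * real (Suc m)) \<le> real d / (2 * real (Suc m))"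
      using assms by (intro divide_right_mono) auto
    then show ?thesis
      by (simp add: powr_def del: of_nat_Suc)
  qed
  ultimately have "exp (- (real d / (2 * real (Suc m)))) \<le> (real (Suc m) / real (Suc (Suc m))) powr (3 / 2)"
    by linarith
  then have "central_multinomial (Suc d) (Suc m)
      \<le> real (Suc m) powr (- 3 / 2) * (real (Suc m) / real (Suc (Suc m))) powr (3 / 2)"
    by (intro order.trans[OF central_multinomial_Suc_le] mult_mono Suc) auto
  also have "\<dots> = real (Suc (Suc m)) powr (- 3 / 2)"
    by (simp add: powr_divide powr_minus_divide field_simps)
  finally show ?case .
qed (simp add: central_multinomial_def)

lemma l2sq_avg_pow_delta_le_1: "l2sq ((avg d ^^ k) (delta v)) \<le> 1"
proof -
  have "l2sq ((avg d ^^ k) (delta v)) \<le> 1 * Sum_any ((avg d ^^ k) (delta v))"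
    by (intro l2sq_le finsupp_avg_pow finsupp_delta avg_pow_nonneg avg_pow_le) (auto simp: delta_def)
  then show ?thesis
    by (simp add: Sum_any_avg_pow finsupp_delta Sum_any_delta)
qed

text \<open>\<open>k\<close> is rounded down to a multiple of d + 1, where the central bound
  applies; the remaining \<open>k mod Suc d\<close> averages cannot raise the maximum. Rounding
  costs the factor (d + 1)^(3/2).\<close>

lemma l2sq_avg_pow_delta_le:
  assumes "d \<ge> 3"
  shows "l2sq ((avg d ^^ k) (delta v)) \<le> real (Suc d) powr (3 / 2) * real (Suc k) powr (- 3 / 2)"
proof -
  define m where "m = k div Suc d"
  have k: "k = k mod Suc d + Suc d * m"
    unfolding m_def by (rule mod_mult_div_eq[symmetric])
  have "(avg d ^^ k) (delta v) w \<le> central_multinomial (Suc d) m" for w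
    by (subst k, unfold funpow_add o_apply, rule avg_pow_le, rule avg_pow_delta_le_central)
  then have "l2sq ((avg d ^^ k) (delta v)) \<le> central_multinomial (Suc d) m * Sum_any ((avg d ^^ k) (delta v))"
    by (intro l2sq_le finsupp_avg_pow finsupp_delta avg_pow_nonneg delta_nonneg)
  also have "\<dots> \<le> real (Suc m) powr (- 3 / 2)"
    using central_multinomial_le[OF assms] by (simp add: Sum_any_avg_pow finsupp_delta Sum_any_delta)
  also have "\<dots> \<le> (real (Suc k) / real (Suc d)) powr (- 3 / 2)"
  proof (rule powr_mono2')
    have "k < Suc d * Suc m"
      unfolding m_def using dividend_less_times_div[of "Suc d" k] by simp
    then have "Suc k \<le> Suc d * Suc m"
      by simp
    then have "real (Suc k) \<le> real (Suc d) * real (Suc m)"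
      by (simp only: of_nat_mult[symmetric] of_nat_le_iff)
    then show "real (Suc k) / real (Suc d) \<le> real (Suc m)"
      by (simp add: field_simps)
  qed auto
  also have "\<dots> = real (Suc d) powr (3 / 2) * real (Suc k) powr (- 3 / 2)"
    by (simp add: powr_divide powr_minus_divide field_simps)
  finally show ?thesis .
qed

lemma sum_l2sq_avg_pow_delta_bounded:
  assumes "d \<ge> 3"
  obtains C where "\<And>v t. (\<Sum>k<t. l2sq ((avg d ^^ k) (delta v))) \<le> C"
proof
  fix v t
  have "summable (\<lambda>k. real (Suc k) powr (- 3 / 2))"
    by (subst summable_Suc_iff[of "\<lambda>k. real k powr (- 3 / 2)"]) (simp add: summable_real_powr_iff)
  then have sm: "summable (\<lambda>k. real (Suc d) powr (3 / 2) * real (Suc k) powr (- 3 / 2))"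
    by (rule summable_mult)
  have "(\<Sum>k<t. l2sq ((avg d ^^ k) (delta v)))
      \<le> (\<Sum>k<t. real (Suc d) powr (3 / 2) * real (Suc k) powr (- 3 / 2))"
    by (intro sum_mono l2sq_avg_pow_delta_le assms)
  also have "\<dots> \<le> suminf (\<lambda>k. real (Suc d) powr (3 / 2) * real (Suc k) powr (- 3 / 2))"
    by (rule sum_le_suminf[OF sm]) auto
  finally show "(\<Sum>k<t. l2sq ((avg d ^^ k) (delta v)))
      \<le> suminf (\<lambda>k. real (Suc d) powr (3 / 2) * real (Suc k) powr (- 3 / 2))" .
qed

section \<open>Moments in the broadcast model\<close>

text \<open>Closed under linear combinations and strong enough to make products integrable, so that
  the expectations below may be split term by term.\<close>

definition sq_integrable :: "'a measure \<Rightarrow> ('a \<Rightarrow> real) \<Rightarrow> bool" where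
  "sq_integrable M f \<longleftrightarrow> f \<in> borel_measurable M \<and> integrable M (\<lambda>x. (f x)\<^sup>2)"

lemma sq_integrable_mult_integrable:
  assumes "sq_integrable M f" "sq_integrable M g"
  shows "integrable M (\<lambda>x. f x * g x)"
proof (rule Bochner_Integration.integrable_bound)
  show "integrable M (\<lambda>x. (f x)\<^sup>2 + (g x)\<^sup>2)"
    using assms by (auto simp: sq_integrable_def)
  show "(\<lambda>x. f x * g x) \<in> borel_measurable M"
    using assms by (auto simp: sq_integrable_def)
  have "\<bar>a * b\<bar> \<le> \<bar>a\<^sup>2 + b\<^sup>2\<bar>" for a b :: real
  proof -
    have "2 * (\<bar>a\<bar> * \<bar>b\<bar>) \<le> a\<^sup>2 + b\<^sup>2"
      using sum_squares_bound[of "\<bar>a\<bar>" "\<bar>b\<bar>"] by simp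
    moreover have "0 \<le> \<bar>a\<bar> * \<bar>b\<bar>"
      by simp
    ultimately show ?thesis
      unfolding abs_mult by linarith
  qed
  then show "AE x in M. norm (f x * g x) \<le> norm ((f x)\<^sup>2 + (g x)\<^sup>2)"
    by simp
qed

lemma sq_integrable_add:
  assumes "sq_integrable M f" "sq_integrable M g"
  shows "sq_integrable M (\<lambda>x. f x + g x)"
proof -
  have "(\<lambda>x. (f x + g x)\<^sup>2) = (\<lambda>x. (f x)\<^sup>2 + (g x)\<^sup>2 + 2 * (f x * g x))"
    by (auto simp: power2_eq_square algebra_simps)
  then show ?thesis
    using assms sq_integrable_mult_integrable[OF assms] by (auto simp: sq_integrable_def)
qed

lemma sq_integrable_cmult: "sq_integrable M f \<Longrightarrow> sq_integrable M (\<lambda>x. c * f x)"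
  by (auto simp: sq_integrable_def power_mult_distrib)

lemma sq_integrable_sum:
  "(\<And>i. i \<in> A \<Longrightarrow> sq_integrable M (f i)) \<Longrightarrow> sq_integrable M (\<lambda>x. \<Sum>i\<in>A. f i x)"
proof (induction A rule: infinite_finite_induct)
  case (insert a A)
  then show ?case
    by (simp add: sq_integrable_add)
qed (simp_all add: sq_integrable_def)

lemma integral_sum_mult:
  assumes "\<And>i. i \<in> A \<Longrightarrow> sq_integrable M (f i)" "sq_integrable M g"
  shows "(\<integral>x. (\<Sum>i\<in>A. f i x) * g x \<partial>M) = (\<Sum>i\<in>A. \<integral>x. f i x * g x \<partial>M)"
  unfolding sum_distrib_right
  by (intro Bochner_Integration.integral_sum sq_integrable_mult_integrable assms)

section \<open>First and second moments of the vertex variables\<close>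

locale broadcast_HS = prob_space M for M :: "'a measure" +
  fixes d :: nat and \<alpha> :: real and X0 :: "'a \<Rightarrow> real"
    and W :: "pt \<times> nat \<Rightarrow> 'a \<Rightarrow> real" and X :: "pt \<Rightarrow> 'a \<Rightarrow> real"
  assumes model: "gaussian_broadcast_HS d \<alpha> M X0 W X"
begin

lemma std_normal_moments:
  assumes D: "distributed M lborel Y std_normal_density"
  shows "sq_integrable M Y" "expectation Y = 0" "expectation (\<lambda>x. (Y x)\<^sup>2) = 1"
proof -
  have "Y \<in> borel_measurable M"
    using distributed_measurable[OF D] by simp
  moreover have "integrable lborel (\<lambda>x. std_normal_density x * x\<^sup>2)"
    by (rule integrable_std_normal_moment)
  then have "integrable M (\<lambda>x. (Y x)\<^sup>2)"
    by (subst (asm) distributed_integrable[OF D]) auto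
  ultimately show "sq_integrable M Y"
    by (simp add: sq_integrable_def)
  show E: "expectation Y = 0"
    by (rule standard_normal_distributed_expectation[OF D])
  show "expectation (\<lambda>x. (Y x)\<^sup>2) = 1"
    using standard_normal_distributed_variance[OF D] E by simp
qed

lemma X0_moments: "sq_integrable M X0" "expectation X0 = 0" "expectation (\<lambda>x. (X0 x)\<^sup>2) = 1"
  using std_normal_moments[of X0] model by (auto simp: gaussian_broadcast_HS_def)

lemma W_moments:
  assumes "e \<in> edges d"
  shows "sq_integrable M (W e)" "expectation (W e) = 0" "expectation (\<lambda>x. (W e x)\<^sup>2) = 1"
  using std_normal_moments[of "W e"] model assms by (auto simp: gaussian_broadcast_HS_def)

lemma sq_integrable_integrable: "sq_integrable M f \<Longrightarrow> integrable M f"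
  by (auto simp: sq_integrable_def intro: square_integrable_imp_integrable)

text \<open>The form in which independence enters: distinct sources are orthogonal in L2, with
  \<open>None\<close> standing for the root.\<close>

lemma uncorrelated_sources:
  defines "Y \<equiv> (\<lambda>j. case j of None \<Rightarrow> X0 | Some e \<Rightarrow> W e)"
  assumes "i \<in> insert None (Some ` edges d)" "j \<in> insert None (Some ` edges d)" "i \<noteq> j"
  shows "expectation (\<lambda>x. Y i x * Y j x) = 0"
proof -
  have "indep_vars (\<lambda>_. borel) Y (insert None (Some ` edges d))"
    using model by (simp add: gaussian_broadcast_HS_def Y_def)
  then have ind: "indep_vars (\<lambda>_. borel) Y {i, j}"
    by (rule indep_vars_subset) (use assms in auto)
  have Y: "sq_integrable M (Y k) \<and> expectation (Y k) = 0" if "k \<in> insert None (Some ` edges d)" for k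
    using that X0_moments W_moments by (auto simp: Y_def)
  have "expectation (\<lambda>x. \<Prod>k\<in>{i, j}. Y k x) = (\<Prod>k\<in>{i, j}. expectation (Y k))"
    by (rule indep_vars_lebesgue_integral[OF _ ind])
       (use Y assms sq_integrable_integrable in auto)
  then show ?thesis
    using assms Y by simp
qed

lemma expectation_W_X0: "e \<in> edges d \<Longrightarrow> expectation (\<lambda>x. W e x * X0 x) = 0"
  using uncorrelated_sources[of "Some e" None] by simp

lemma expectation_W_W: "e \<in> edges d \<Longrightarrow> e' \<in> edges d \<Longrightarrow> e \<noteq> e' \<Longrightarrow> expectation (\<lambda>x. W e x * W e' x) = 0"
  using uncorrelated_sources[of "Some e" "Some e'"] by simp

abbreviation \<beta> :: real where "\<beta> \<equiv> \<alpha> * real (d + 1)"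

lemma layer_edge: "v \<in> layer d (Suc t) \<Longrightarrow> i \<le> d \<Longrightarrow> (v, i) \<in> edges d"
  by (auto simp: layer_def edges_def)

lemma X_root: "v \<in> layer d 0 \<Longrightarrow> X v = X0"
  using model by (auto simp: gaussian_broadcast_HS_def)

lemma X_step:
  assumes "v \<in> layer d (Suc t)"
  shows "X v = (\<lambda>\<omega>. \<alpha> * (\<Sum>i\<le>d. X (v - unit_vec i) \<omega> + W (v, i) \<omega>))"
proof -
  have "\<forall>t\<ge>1. \<forall>v\<in>layer d t. X v = (\<lambda>\<omega>. \<alpha> * (\<Sum>i\<le>d. X (v - unit_vec i) \<omega> + W (v, i) \<omega>))"
    using model unfolding gaussian_broadcast_HS_def by (elim conjE)
  moreover have "1 \<le> Suc t"
    by simp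
  ultimately show ?thesis
    using assms by blast
qed

text \<open>Tested against an arbitrary square-integrable \<open>g\<close>, so that one computation
  serves the constant 1, the root and a noise variable.\<close>

lemma expectation_X_step:
  assumes v: "v \<in> layer d (Suc t)" and g: "sq_integrable M g"
    and sq: "\<And>i. i \<le> d \<Longrightarrow> sq_integrable M (X (v - unit_vec i))"
  shows "expectation (\<lambda>\<omega>. X v \<omega> * g \<omega>)
    = \<alpha> * (\<Sum>i\<le>d. expectation (\<lambda>\<omega>. X (v - unit_vec i) \<omega> * g \<omega>) + expectation (\<lambda>\<omega>. W (v, i) \<omega> * g \<omega>))"
proof -
  have W: "sq_integrable M (W (v, i))" if "i \<le> d" for i
    using W_moments(1) layer_edge[OF v that] by blast
  have "expectation (\<lambda>\<omega>. X v \<omega> * g \<omega>)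
      = expectation (\<lambda>\<omega>. \<alpha> * ((\<Sum>i\<le>d. X (v - unit_vec i) \<omega> + W (v, i) \<omega>) * g \<omega>))"
    by (simp add: X_step[OF v] mult.assoc)
  also have "\<dots> = \<alpha> * (\<Sum>i\<le>d. expectation (\<lambda>\<omega>. (X (v - unit_vec i) \<omega> + W (v, i) \<omega>) * g \<omega>))"
    by (subst integral_mult_right_zero, subst integral_sum_mult)
       (auto intro: sq_integrable_add sq W g)
  also have "(\<Sum>i\<le>d. expectation (\<lambda>\<omega>. (X (v - unit_vec i) \<omega> + W (v, i) \<omega>) * g \<omega>))
    = (\<Sum>i\<le>d. expectation (\<lambda>\<omega>. X (v - unit_vec i) \<omega> * g \<omega>) + expectation (\<lambda>\<omega>. W (v, i) \<omega> * g \<omega>))"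
    unfolding distrib_right
    by (intro sum.cong refl Bochner_Integration.integral_add sq_integrable_mult_integrable sq W g) auto
  finally show ?thesis .
qed

text \<open>The fourth claim holds because \<open>X v\<close> is built from the root and the noise
  on edges into ranks at most t; the inequality is strict because \<open>X v\<close> contains the
  noise on the edges into \<open>v\<close> itself. This claim makes the noise fresh when a statistic
  is pulled back.\<close>

lemma X_moments:
  assumes "v \<in> layer d t"
  shows "sq_integrable M (X v)" "expectation (X v) = 0" "expectation (\<lambda>\<omega>. X v \<omega> * X0 \<omega>) = \<beta> ^ t"
    "\<And>e. e \<in> edges d \<Longrightarrow> coord_sum d (fst e) > int t \<Longrightarrow> expectation (\<lambda>\<omega>. X v \<omega> * W e \<omega>) = 0"
proof -
  have "sq_integrable M (X v) \<and> expectation (X v) = 0 \<and> expectation (\<lambda>\<omega>. X v \<omega> * X0 \<omega>) = \<beta> ^ t \<and>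
    (\<forall>e \<in> edges d. coord_sum d (fst e) > int t \<longrightarrow> expectation (\<lambda>\<omega>. X v \<omega> * W e \<omega>) = 0)"
    using assms
  proof (induction t arbitrary: v)
    case 0
    then show ?case
      using X0_moments expectation_W_X0 by (auto simp: X_root power2_eq_square mult.commute)
  next
    case (Suc t)
    note v = Suc.prems
    note IH = Suc.IH[OF layer_minus_unit_vec[OF v]]
    note W = W_moments[OF layer_edge[OF v]]
    have sq: "sq_integrable M (X (v - unit_vec i))" if "i \<le> d" for i
      using IH that by blast
    have "sq_integrable M (X v)"
      unfolding X_step[OF v]
      by (intro sq_integrable_cmult sq_integrable_sum sq_integrable_add) (use sq W in auto)
    moreover have "expectation (X v) = 0"
    proof -
      have "sq_integrable M (\<lambda>_. 1)"
        by (simp add: sq_integrable_def)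
      from expectation_X_step[OF v this sq] show ?thesis
        using IH W by simp
    qed
    moreover have "expectation (\<lambda>\<omega>. X v \<omega> * X0 \<omega>) = \<beta> ^ Suc t"
      using expectation_X_step[OF v X0_moments(1) sq] IH expectation_W_X0[OF layer_edge[OF v]] by simp
    moreover have "expectation (\<lambda>\<omega>. X v \<omega> * W e \<omega>) = 0"
      if e: "e \<in> edges d" "coord_sum d (fst e) > int (Suc t)" for e
    proof -
      have "(v, i) \<noteq> e" for i
        using v e(2) by (auto simp: layer_def)
      then have "expectation (\<lambda>\<omega>. W (v, i) \<omega> * W e \<omega>) = 0" if "i \<le> d" for i
        using expectation_W_W[OF layer_edge[OF v] e(1)] that by blast
      then show ?thesis
        using expectation_X_step[OF v W_moments(1)[OF e(1)] sq] IH e by simp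
    qed
    ultimately show ?case
      by blast
  qed
  then show "sq_integrable M (X v)" "expectation (X v) = 0" "expectation (\<lambda>\<omega>. X v \<omega> * X0 \<omega>) = \<beta> ^ t"
    "\<And>e. e \<in> edges d \<Longrightarrow> coord_sum d (fst e) > int t \<Longrightarrow> expectation (\<lambda>\<omega>. X v \<omega> * W e \<omega>) = 0"
    by blast+
qed

lemma expectation_square_W_sum:
  assumes "finite A" "A \<subseteq> edges d"
  shows "expectation (\<lambda>\<omega>. (\<Sum>e\<in>A. c e * W e \<omega>)\<^sup>2) = (\<Sum>e\<in>A. (c e)\<^sup>2)"
proof -
  have sq: "sq_integrable M (\<lambda>\<omega>. c e * W e \<omega>)" if "e \<in> A" for e
    using that assms by (intro sq_integrable_cmult W_moments(1)) auto
  have inner: "expectation (\<lambda>\<omega>. (c e * W e \<omega>) * (c e' * W e' \<omega>)) = (if e = e' then (c e)\<^sup>2 else 0)"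
    if "e \<in> A" "e' \<in> A" for e e'
  proof -
    have "expectation (\<lambda>\<omega>. (c e * W e \<omega>) * (c e' * W e' \<omega>))
        = expectation (\<lambda>\<omega>. (c e * c e') * (W e \<omega> * W e' \<omega>))"
      by (simp add: mult_ac)
    also have "\<dots> = (c e * c e') * expectation (\<lambda>\<omega>. W e \<omega> * W e' \<omega>)"
      by (rule integral_mult_right_zero)
    also have "\<dots> = (if e = e' then (c e)\<^sup>2 else 0)"
      using that assms(2) expectation_W_W[of e e'] W_moments(3)[of e]
      by (auto simp: power2_eq_square)
    finally show ?thesis .
  qed
  have "expectation (\<lambda>\<omega>. (\<Sum>e\<in>A. c e * W e \<omega>)\<^sup>2)
      = (\<Sum>e\<in>A. expectation (\<lambda>\<omega>. (c e * W e \<omega>) * (\<Sum>e'\<in>A. c e' * W e' \<omega>)))"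
    unfolding power2_eq_square by (intro integral_sum_mult sq_integrable_sum sq)
  also have "\<dots> = (\<Sum>e\<in>A. \<Sum>e'\<in>A. expectation (\<lambda>\<omega>. (c e * W e \<omega>) * (c e' * W e' \<omega>)))"
    unfolding sum_distrib_left
    by (intro sum.cong refl Bochner_Integration.integral_sum sq_integrable_mult_integrable sq)
  also have "\<dots> = (\<Sum>e\<in>A. (c e)\<^sup>2)"
    using inner assms(1) by simp
  finally show ?thesis .
qed

section \<open>Linear statistics of one layer and their variance\<close>

definition linear_stat :: "(pt \<Rightarrow> real) \<Rightarrow> 'a \<Rightarrow> real" where
  "linear_stat f \<omega> = Sum_any (\<lambda>w. f w * X w \<omega>)"

lemma linear_stat_eq_sum: "finsupp f \<Longrightarrow> linear_stat f = (\<lambda>\<omega>. \<Sum>w | f w \<noteq> 0. f w * X w \<omega>)"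
  unfolding linear_stat_def by (rule ext, rule Sum_any_finsupp) auto

text \<open>Solves the recursion of pulling \<open>f\<close> back to the root. Term k is the noise
  on the edges into layer t - k; layer 0 has no incoming edges, hence the range k < t and the
  separate root term.\<close>

definition stat_variance :: "nat \<Rightarrow> (pt \<Rightarrow> real) \<Rightarrow> real" where
  "stat_variance t f = \<beta> ^ (2 * t) * (Sum_any f)\<^sup>2
     + \<alpha>\<^sup>2 * real (d + 1) * (\<Sum>k<t. \<beta> ^ (2 * k) * l2sq ((avg d ^^ k) f))"

lemma linear_stat_sq_integrable:
  assumes "finsupp f" "{w. f w \<noteq> 0} \<subseteq> layer d t"
  shows "sq_integrable M (linear_stat f)"
  unfolding linear_stat_eq_sum[OF assms(1)]
  using assms(2) by (intro sq_integrable_sum sq_integrable_cmult X_moments(1)) auto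

lemma linear_stat_mult_expectation:
  assumes "finsupp f" "{w. f w \<noteq> 0} \<subseteq> layer d t" "sq_integrable M g"
  shows "expectation (\<lambda>\<omega>. linear_stat f \<omega> * g \<omega>) = (\<Sum>w | f w \<noteq> 0. f w * expectation (\<lambda>\<omega>. X w \<omega> * g \<omega>))"
  unfolding linear_stat_eq_sum[OF assms(1)]
proof (subst integral_sum_mult)
  show "sq_integrable M (\<lambda>\<omega>. f w * X w \<omega>)" if "w \<in> {w. f w \<noteq> 0}" for w
    using that assms(2) by (intro sq_integrable_cmult X_moments(1)) auto
qed (use assms(3) in \<open>simp_all add: mult.assoc\<close>)

lemma linear_stat_expectation:
  assumes "finsupp f" "{w. f w \<noteq> 0} \<subseteq> layer d t"
  shows "expectation (linear_stat f) = 0"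
proof -
  have "sq_integrable M (\<lambda>_. 1)"
    by (simp add: sq_integrable_def)
  from linear_stat_mult_expectation[OF assms this] show ?thesis
    using assms(2) X_moments(2) by (auto intro!: sum.neutral)
qed

lemma linear_stat_X0:
  assumes "finsupp f" "{w. f w \<noteq> 0} \<subseteq> layer d t"
  shows "expectation (\<lambda>\<omega>. linear_stat f \<omega> * X0 \<omega>) = \<beta> ^ t * Sum_any f"
proof -
  have "(\<Sum>w | f w \<noteq> 0. f w * expectation (\<lambda>\<omega>. X w \<omega> * X0 \<omega>)) = (\<Sum>w | f w \<noteq> 0. f w * \<beta> ^ t)"
    using assms(2) X_moments(3) by (intro sum.cong refl) auto
  then show ?thesis
    unfolding linear_stat_mult_expectation[OF assms X0_moments(1)]
    by (simp add: sum_distrib_left Sum_any.expand_set mult.commute)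
qed

lemma linear_stat_step:
  assumes "finsupp f" "{w. f w \<noteq> 0} \<subseteq> layer d (Suc t)"
  shows "linear_stat f \<omega> = \<beta> * linear_stat (avg d f) \<omega>
           + \<alpha> * (\<Sum>e\<in>{w. f w \<noteq> 0} \<times> {..d}. f (fst e) * W e \<omega>)"
proof -
  let ?A = "{w. f w \<noteq> 0}"
  have "linear_stat (avg d f) \<omega> = Sum_any (\<lambda>w. f w * ((\<Sum>i\<le>d. X (w - unit_vec i) \<omega>) / real (d + 1)))"
    unfolding linear_stat_def by (rule Sum_any_avg_mult) fact
  also have "\<dots> = (\<Sum>w\<in>?A. f w * ((\<Sum>i\<le>d. X (w - unit_vec i) \<omega>) / real (d + 1)))"
    by (rule Sum_any_finsupp) (use assms in auto)
  finally have eq: "linear_stat (avg d f) \<omega> = \<dots>" .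
  have avg: "\<beta> * linear_stat (avg d f) \<omega> = (\<Sum>w\<in>?A. \<alpha> * f w * (\<Sum>i\<le>d. X (w - unit_vec i) \<omega>))"
    unfolding eq sum_distrib_left[of \<beta>] by (intro sum.cong refl) simp
  have "linear_stat f \<omega> = (\<Sum>w\<in>?A. f w * (\<alpha> * (\<Sum>i\<le>d. X (w - unit_vec i) \<omega> + W (w, i) \<omega>)))"
    unfolding linear_stat_eq_sum[OF assms(1)]
    using assms(2) by (intro sum.cong refl) (auto simp: X_step)
  also have "\<dots> = (\<Sum>w\<in>?A. \<alpha> * f w * (\<Sum>i\<le>d. X (w - unit_vec i) \<omega>))
      + \<alpha> * (\<Sum>w\<in>?A. \<Sum>i\<le>d. f w * W (w, i) \<omega>)"
  proof -
    have "f w * (\<alpha> * (\<Sum>i\<le>d. X (w - unit_vec i) \<omega> + W (w, i) \<omega>))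
        = \<alpha> * f w * (\<Sum>i\<le>d. X (w - unit_vec i) \<omega>) + \<alpha> * (\<Sum>i\<le>d. f w * W (w, i) \<omega>)" for w
      by (simp add: sum.distrib distrib_left sum_distrib_left[symmetric])
    then show ?thesis
      by (simp add: sum.distrib sum_distrib_left[symmetric])
  qed
  also have "(\<Sum>w\<in>?A. \<Sum>i\<le>d. f w * W (w, i) \<omega>) = (\<Sum>e\<in>?A \<times> {..d}. f (fst e) * W e \<omega>)"
    by (simp add: sum.cartesian_product case_prod_unfold)
  finally show ?thesis
    unfolding avg .
qed

lemma stat_variance_Suc:
  assumes "finsupp f"
  shows "stat_variance (Suc t) f = \<beta>\<^sup>2 * stat_variance t (avg d f) + \<alpha>\<^sup>2 * real (d + 1) * l2sq f"
proof -
  have "(\<Sum>k<Suc t. \<beta> ^ (2 * k) * l2sq ((avg d ^^ k) f))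
      = l2sq f + \<beta>\<^sup>2 * (\<Sum>k<t. \<beta> ^ (2 * k) * l2sq ((avg d ^^ k) (avg d f)))"
    unfolding sum.lessThan_Suc_shift sum_distrib_left
    by (simp add: funpow_swap1 power_add power2_eq_square mult_ac)
  then show ?thesis
    using assms by (simp only: stat_variance_def Sum_any_avg) (simp add: algebra_simps power_add power2_eq_square)
qed

text \<open>In the square of the one-step pull-back the mixed term vanishes, which leaves the
  recursion \<open>stat_variance_Suc\<close>. On layer 0 all points carry the same variable, so only
  the total of the coefficients survives there.\<close>

lemma linear_stat_square:
  assumes "finsupp f" "{w. f w \<noteq> 0} \<subseteq> layer d t"
  shows "expectation (\<lambda>\<omega>. (linear_stat f \<omega>)\<^sup>2) = stat_variance t f"
  using assms
proof (induction t arbitrary: f)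
  case 0
  then have "(\<Sum>w | f w \<noteq> 0. f w * X w \<omega>) = (\<Sum>w | f w \<noteq> 0. f w * X0 \<omega>)" for \<omega>
    by (intro sum.cong refl) (auto simp: X_root)
  then have "linear_stat f = (\<lambda>\<omega>. Sum_any f * X0 \<omega>)"
    unfolding linear_stat_eq_sum[OF 0(1)] by (simp add: Sum_any.expand_set sum_distrib_right)
  then show ?case
    using X0_moments(3) by (simp add: stat_variance_def power_mult_distrib)
next
  case (Suc t)
  let ?A = "{w. f w \<noteq> 0}"
  define R where "R \<omega> = (\<Sum>e\<in>?A \<times> {..d}. f (fst e) * W e \<omega>)" for \<omega>
  let ?Z = "linear_stat (avg d f)"
  have edges: "?A \<times> {..d} \<subseteq> edges d"
    using Suc.prems(2) layer_edge by auto
  have g: "finsupp (avg d f)" "{w. avg d f w \<noteq> 0} \<subseteq> layer d t"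
    using Suc.prems by (simp_all add: finsupp_avg supp_avg_layer)
  have sqZ: "sq_integrable M ?Z"
    by (rule linear_stat_sq_integrable[OF g])
  have sqR: "sq_integrable M R"
    unfolding R_def by (intro sq_integrable_sum sq_integrable_cmult W_moments(1)) (use edges in auto)
  have R2: "expectation (\<lambda>\<omega>. (R \<omega>)\<^sup>2) = real (d + 1) * l2sq f"
  proof -
    have "expectation (\<lambda>\<omega>. (R \<omega>)\<^sup>2) = (\<Sum>e\<in>?A \<times> {..d}. (f (fst e))\<^sup>2)"
      unfolding R_def using Suc.prems(1) by (intro expectation_square_W_sum edges) simp
    also have "\<dots> = (\<Sum>w\<in>?A. \<Sum>i\<le>d. (f w)\<^sup>2)"
      unfolding sum.cartesian_product by (simp add: case_prod_unfold)
    also have "\<dots> = real (d + 1) * (\<Sum>w\<in>?A. (f w)\<^sup>2)"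
      by (simp add: sum_distrib_left)
    also have "(\<Sum>w\<in>?A. (f w)\<^sup>2) = l2sq f"
      unfolding l2sq_def by (rule Sum_any_finsupp[symmetric]) (use Suc.prems in auto)
    finally show ?thesis .
  qed
  \<comment> \<open>The edges in \<open>R\<close> end in layer t + 1, one above \<open>u\<close>, as
    the strict inequality in \<open>X_moments(4)\<close> demands.\<close>
  have XR: "expectation (\<lambda>\<omega>. X u \<omega> * R \<omega>) = 0" if u: "u \<in> layer d t" for u
  proof -
    have "expectation (\<lambda>\<omega>. R \<omega> * X u \<omega>)
        = (\<Sum>e\<in>?A \<times> {..d}. expectation (\<lambda>\<omega>. f (fst e) * W e \<omega> * X u \<omega>))"
      unfolding R_def using edges
      by (intro integral_sum_mult sq_integrable_cmult W_moments(1) X_moments(1)[OF u]) auto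
    also have "\<dots> = 0"
    proof (intro sum.neutral ballI)
      fix e assume e: "e \<in> ?A \<times> {..d}"
      then have "coord_sum d (fst e) > int t"
        using Suc.prems(2) by (auto simp: layer_def)
      then have "expectation (\<lambda>\<omega>. X u \<omega> * W e \<omega>) = 0"
        using X_moments(4)[OF u] e edges by blast
      moreover have "(\<lambda>\<omega>. f (fst e) * W e \<omega> * X u \<omega>) = (\<lambda>\<omega>. f (fst e) * (X u \<omega> * W e \<omega>))"
        by (simp add: mult_ac)
      ultimately show "expectation (\<lambda>\<omega>. f (fst e) * W e \<omega> * X u \<omega>) = 0"
        by simp
    qed
    finally show ?thesis
      by (simp add: mult.commute)
  qed
  have ZR: "expectation (\<lambda>\<omega>. ?Z \<omega> * R \<omega>) = 0"
    unfolding linear_stat_mult_expectation[OF g sqR]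
    using XR g(2) by (intro sum.neutral) auto
  have "(\<lambda>\<omega>. (linear_stat f \<omega>)\<^sup>2)
      = (\<lambda>\<omega>. \<beta>\<^sup>2 * (?Z \<omega>)\<^sup>2 + (2 * \<alpha> * \<beta>) * (?Z \<omega> * R \<omega>) + \<alpha>\<^sup>2 * (R \<omega>)\<^sup>2)"
    unfolding linear_stat_step[OF Suc.prems] R_def[symmetric]
    by (simp add: power2_eq_square algebra_simps)
  then have "expectation (\<lambda>\<omega>. (linear_stat f \<omega>)\<^sup>2)
      = \<beta>\<^sup>2 * expectation (\<lambda>\<omega>. (?Z \<omega>)\<^sup>2) + (2 * \<alpha> * \<beta>) * expectation (\<lambda>\<omega>. ?Z \<omega> * R \<omega>)
        + \<alpha>\<^sup>2 * expectation (\<lambda>\<omega>. (R \<omega>)\<^sup>2)"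
    using sqZ sqR sq_integrable_mult_integrable[OF sqZ sqR]
    by (simp add: sq_integrable_def)
  then show ?case
    using Suc.IH[OF g] ZR R2 Suc.prems(1) by (simp only: stat_variance_Suc)
qed

lemma variance_linear_stat:
  assumes "finsupp f" "{w. f w \<noteq> 0} \<subseteq> layer d t"
  shows "variance (linear_stat f) = stat_variance t f"
  using linear_stat_square[OF assms] linear_stat_expectation[OF assms] by simp

lemma correlation_linear_stat:
  assumes "finsupp f" "{w. f w \<noteq> 0} \<subseteq> layer d t"
  shows "correlation M (linear_stat f) X0 = \<beta> ^ t * Sum_any f / sqrt (stat_variance t f)"
  using linear_stat_X0[OF assms] linear_stat_expectation[OF assms] X0_moments linear_stat_square[OF assms]
  by (simp add: correlation_def covariance_def)

end

section \<open>Lower bounds on the averages and the phase transition\<close>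

lemma window_card:
  shows "finite (window d N a)" "card (window d N a) \<le> N ^ (d + 1)"
proof -
  let ?P = "Pi\<^sub>E {..d} (\<lambda>i. {a i..<a i + int N})"
  have sub: "(\<lambda>w. restrict w {..d}) ` window d N a \<subseteq> ?P"
    by (auto simp: PiE_iff extensional_def window_def split: if_splits)
  have inj: "inj_on (\<lambda>w. restrict w {..d}) (window d N a)"
  proof (rule inj_onI)
    fix v w assume v: "v \<in> window d N a" and w: "w \<in> window d N a"
      and eq: "restrict v {..d} = restrict w {..d}"
    have "v j = w j" if "j \<le> d" for j
      using fun_cong[OF eq, of j] that by simp
    moreover have "v j = w j" if "j > d" for j
      using v w that by (simp add: window_def HS_def)
    ultimately show "v = w"
      by (metis ext not_le)
  qed
  have fin: "finite ?P"
    by (intro finite_PiE) auto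
  show "finite (window d N a)"
    using finite_imageD[OF finite_subset[OF sub fin] inj] .
  have "card (window d N a) \<le> card ?P"
    by (rule card_inj_on_le[OF inj sub fin])
  then show "card (window d N a) \<le> N ^ (d + 1)"
    by (simp add: card_PiE)
qed

lemma finsupp_window: "{w. f w \<noteq> 0} \<subseteq> window d N a \<Longrightarrow> finsupp f"
  using window_card(1) finite_subset by blast

lemma Sum_any_abs_ge: "finsupp f \<Longrightarrow> \<bar>Sum_any f\<bar> \<le> Sum_any (\<lambda>w. \<bar>f w\<bar>)"
  by (subst (1 2) Sum_any_finsupp[of f]) auto

text \<open>Cauchy-Schwarz on the support, whose size is bounded independently of the position of
  the window. It turns the noise of the last layer into control of the l1 norm.\<close>

lemma Sum_any_abs_squared_le:
  assumes "{w. f w \<noteq> 0} \<subseteq> window d N a"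
  shows "(Sum_any (\<lambda>w. \<bar>f w\<bar>))\<^sup>2 \<le> real N ^ (d + 1) * l2sq f"
proof -
  note fin = finsupp_window[OF assms]
  have "(Sum_any (\<lambda>w. \<bar>f w\<bar>))\<^sup>2 = (\<Sum>w | f w \<noteq> 0. \<bar>f w\<bar>)\<^sup>2"
    by (subst Sum_any_finsupp[OF fin]) auto
  also have "\<dots> \<le> (\<Sum>w | f w \<noteq> 0. \<bar>f w\<bar>\<^sup>2) * real (card {w. f w \<noteq> 0})"
    by (rule sum_squared_le_sum_of_squares)
  also have "(\<Sum>w | f w \<noteq> 0. \<bar>f w\<bar>\<^sup>2) = l2sq f"
    unfolding l2sq_def by (subst Sum_any_finsupp[OF fin]) auto
  also have "l2sq f * real (card {w. f w \<noteq> 0}) \<le> l2sq f * real (N ^ (d + 1))"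
    using card_mono[OF window_card(1) assms] window_card(2)[of d N a]
    by (intro mult_left_mono l2sq_nonneg fin) linarith
  finally show ?thesis
    by (simp add: mult.commute)
qed

lemma Sum_any_spread_window_le:
  assumes "{w. f w \<noteq> 0} \<subseteq> window d N a" "\<And>w. 0 \<le> f w"
  shows "Sum_any (\<lambda>w. f w * spread d a 0 w) \<le> real (d + 1) * (real N)\<^sup>2 * Sum_any f"
proof -
  note fin = finsupp_window[OF assms(1)]
  have le: "spread d a 0 w \<le> real (d + 1) * (real N)\<^sup>2" if "w \<in> window d N a" for w
  proof -
    have "spread d a 0 w \<le> (\<Sum>j\<le>d. (real N)\<^sup>2)"
      unfolding spread_def
    proof (rule sum_mono)
      fix j assume "j \<in> {..d}"
      then have "0 \<le> w j - a j" "w j - a j \<le> int N"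
        using that by (auto simp: window_def)
      then have "0 \<le> real_of_int (w j - a j)" "real_of_int (w j - a j) \<le> real N"
        by linarith+
      then show "(real_of_int (w j) - real_of_int (a j) + real 0 / real (d + 1))\<^sup>2 \<le> (real N)\<^sup>2"
        by (intro power_mono) auto
    qed
    then show ?thesis
      by simp
  qed
  have "Sum_any (\<lambda>w. f w * spread d a 0 w) = (\<Sum>w | f w \<noteq> 0. f w * spread d a 0 w)"
    by (rule Sum_any_finsupp[OF fin]) auto
  also have "\<dots> \<le> (\<Sum>w | f w \<noteq> 0. f w * (real (d + 1) * (real N)\<^sup>2))"
    using assms le by (intro sum_mono mult_left_mono) auto
  also have "\<dots> = real (d + 1) * (real N)\<^sup>2 * Sum_any f"
    by (simp add: sum_distrib_right[symmetric] Sum_any.expand_set[of f] mult.commute)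
  finally show ?thesis .
qed

text \<open>The box that carries at least half of the mass has \<open>O((k + 1) powr (d / 2))\<close> points, because the
  spread grows by at most 1 per step; for \<open>d \<le> 2\<close> this is \<open>O(k + 1)\<close>, and Cauchy-Schwarz on the box
  gives the bound.\<close>
lemma l2sq_avg_pow_lower:
  assumes d: "d \<le> 2"
    and supp: "{w. f w \<noteq> 0} \<subseteq> layer d t \<inter> window d N a"
    and K: "0 < K" "Sum_any (\<lambda>w. \<bar>f w\<bar>) \<le> K * \<bar>Sum_any f\<bar>"
    and k: "k \<le> t"
  shows "(Sum_any f)\<^sup>2 \<le> 4 * (16 * K * (real (d + 1) * (real N)\<^sup>2 + 1) + 2) * real (Suc k) * l2sq ((avg d ^^ k) f)"
proof (cases "Sum_any f = 0")
  case True
  have fin: "finsupp f"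
    using supp finsupp_window by blast
  show ?thesis
    using True K(1) l2sq_nonneg[OF finsupp_avg_pow[OF fin]] by simp
next
  case False
  define S where "S = Sum_any f"
  define L where "L = Sum_any (\<lambda>w. \<bar>f w\<bar>)"
  define V where "V = real (d + 1) * (real N)\<^sup>2 + real k"
  \<comment> \<open>Radius for Chebyshev's inequality: the mass outside the box is at most V L / r^2
    = L / (2 K), hence at most half of the absolute value of \<open>S\<close>.\<close>
  define r where "r = sqrt (2 * K * V)"
  define g where "g = (avg d ^^ k) f"
  \<comment> \<open>\<open>g\<close> may contain cancellation, so second moments are taken for this
    nonnegative majorant.\<close>
  define G where "G = (avg d ^^ k) (\<lambda>w. \<bar>f w\<bar>)"
  define z where "z j = real_of_int (a j) - real k / real (d + 1)" for j
  define B where "B = {w \<in> layer d (t - k). \<forall>j\<le>d. \<bar>of_int (w j) - z j\<bar> \<le> r}"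
  define A where "A = {w. g w \<noteq> 0}"
  have supp_win: "{w. f w \<noteq> 0} \<subseteq> window d N a" and supp_layer: "{w. f w \<noteq> 0} \<subseteq> layer d t"
    using supp by auto
  have fin: "finsupp f" and fin_abs: "finsupp (\<lambda>w. \<bar>f w\<bar>)"
    using finsupp_window[OF supp_win] by auto
  have finA: "finite A"
    unfolding A_def g_def by (rule finsupp_avg_pow[OF fin])
  have finG: "finsupp G"
    unfolding G_def by (rule finsupp_avg_pow[OF fin_abs])
  have A_layer: "A \<subseteq> layer d (t - k)"
    unfolding A_def g_def by (rule supp_avg_pow_layer[OF supp_layer k])
  have G_nonneg: "0 \<le> G w" for w
    unfolding G_def by (rule avg_pow_nonneg) simp
  have g_le_G: "\<bar>g w\<bar> \<le> G w" for w
    unfolding g_def G_def by (rule abs_avg_pow_le)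
  \<comment> \<open>Keeps \<open>V\<close> positive even when k = 0, and with it the radius by which
    Chebyshev's inequality divides.\<close>
  have "N > 0"
  proof (rule ccontr)
    assume "\<not> N > 0"
    then have "window d N a = {}"
      by (auto simp: window_def)
    then have "f = (\<lambda>_. 0)"
      using supp_win by auto
    then show False
      using False by simp
  qed
  then have V: "V > 0"
    by (simp add: V_def add_pos_nonneg)
  have r: "r > 0" "r\<^sup>2 = 2 * K * V"
    using V K by (simp_all add: r_def)
  have moment: "Sum_any (\<lambda>w. G w * spread d a k w) \<le> V * L"
  proof -
    have "Sum_any (\<lambda>w. G w * spread d a k w)
        \<le> Sum_any (\<lambda>w. \<bar>f w\<bar> * spread d a 0 w) + real k * L"
      unfolding G_def L_def by (rule Sum_any_spread_le[OF fin_abs]) simp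
    moreover have "Sum_any (\<lambda>w. \<bar>f w\<bar> * spread d a 0 w) \<le> real (d + 1) * (real N)\<^sup>2 * L"
      unfolding L_def by (rule Sum_any_spread_window_le) (use supp_win in auto)
    ultimately show ?thesis
      by (simp add: V_def algebra_simps)
  qed
  have outside: "\<bar>g w\<bar> \<le> G w * spread d a k w / r\<^sup>2" if "w \<in> A - B" for w
  proof -
    have "w \<in> layer d (t - k)" "w \<notin> B"
      using that A_layer by auto
    then have "\<not> (\<forall>j\<le>d. \<bar>of_int (w j) - z j\<bar> \<le> r)"
      by (simp add: B_def)
    then obtain j where j: "j \<le> d" "r < \<bar>of_int (w j) - z j\<bar>"
      by (auto simp: not_le)
    have "r\<^sup>2 \<le> (of_int (w j) - z j)\<^sup>2"
      using j(2) r(1) abs_le_square_iff[of r "of_int (w j) - z j"] by simp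
    also have "\<dots> = (of_int (w j) - of_int (a j) + real k / real (d + 1))\<^sup>2"
      by (simp add: z_def algebra_simps)
    also have "\<dots> \<le> spread d a k w"
      unfolding spread_def using j(1) by (intro member_le_sum) auto
    finally have "1 \<le> spread d a k w / r\<^sup>2"
      using r(1) by simp
    then have "G w * 1 \<le> G w * (spread d a k w / r\<^sup>2)"
      by (intro mult_left_mono G_nonneg)
    then show ?thesis
      using g_le_G[of w] by simp
  qed
  have "\<bar>\<Sum>w\<in>A - B. g w\<bar> \<le> (\<Sum>w\<in>A - B. \<bar>g w\<bar>)"
    by (rule sum_abs)
  also have "\<dots> \<le> (\<Sum>w\<in>A - B. G w * spread d a k w / r\<^sup>2)"
    by (intro sum_mono outside)
  also have "\<dots> \<le> (\<Sum>w | G w \<noteq> 0. G w * spread d a k w / r\<^sup>2)"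
  proof (rule sum_mono2[OF finG])
    show "A - B \<subseteq> {w. G w \<noteq> 0}"
    proof
      fix w assume "w \<in> A - B"
      then have "g w \<noteq> 0"
        by (simp add: A_def)
      then show "w \<in> {w. G w \<noteq> 0}"
        using g_le_G[of w] by auto
    qed
    show "0 \<le> G w * spread d a k w / r\<^sup>2" for w
      by (intro divide_nonneg_nonneg mult_nonneg_nonneg G_nonneg spread_nonneg) simp
  qed
  also have "\<dots> = Sum_any (\<lambda>w. G w * spread d a k w) / r\<^sup>2"
    unfolding sum_divide_distrib[symmetric]
    by (subst Sum_any_finsupp[OF finG]) auto
  also have "\<dots> \<le> V * L / r\<^sup>2"
    by (intro divide_right_mono moment) simp
  also have "\<dots> = L / (2 * K)"
    using V K(1) by (simp add: r(2))
  also have "\<dots> \<le> \<bar>S\<bar> / 2"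
    using K by (simp add: L_def S_def field_simps)
  finally have small: "\<bar>\<Sum>w\<in>A - B. g w\<bar> \<le> \<bar>S\<bar> / 2" .
  have "S = Sum_any g"
    unfolding S_def g_def by (rule Sum_any_avg_pow[OF fin, symmetric])
  also have "\<dots> = (\<Sum>w\<in>A. g w)"
    by (simp add: A_def Sum_any.expand_set)
  also have "\<dots> = (\<Sum>w\<in>A \<inter> B. g w) + (\<Sum>w\<in>A - B. g w)"
    by (rule sum.Int_Diff[OF finA])
  finally have half: "\<bar>S\<bar> / 2 \<le> \<bar>\<Sum>w\<in>A \<inter> B. g w\<bar>"
    using small by linarith
  have card: "real (card (A \<inter> B)) \<le> (16 * K * (real (d + 1) * (real N)\<^sup>2 + 1) + 2) * real (Suc k)"
  proof -
    have "real (card (A \<inter> B)) \<le> real (card B)"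
      unfolding B_def using r(1) by (intro of_nat_mono card_mono card_layer_box_le(1)) auto
    also have "\<dots> \<le> (2 * r + 1) ^ d"
      unfolding B_def using r(1) by (intro card_layer_box_le(2)) simp
    \<comment> \<open>The use of d \<le> 2: the count is at most quadratic in \<open>r\<close>,
      hence linear in \<open>V\<close> and in k + 1.\<close>
    also have "\<dots> \<le> (2 * r + 1) ^ 2"
      using d r(1) by (intro power_increasing) auto
    also have "\<dots> \<le> 8 * r\<^sup>2 + 2"
      using sum_squares_bound[of "2 * r" 1] by (simp add: power2_eq_square algebra_simps)
    also have "\<dots> = 16 * K * V + 2"
      by (simp add: r(2))
    also have "\<dots> \<le> (16 * K * (real (d + 1) * (real N)\<^sup>2 + 1) + 2) * real (Suc k)"
    proof -
      have "V \<le> (real (d + 1) * (real N)\<^sup>2 + 1) * real (Suc k)"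
        by (simp add: V_def algebra_simps)
      then have "16 * K * V \<le> 16 * K * ((real (d + 1) * (real N)\<^sup>2 + 1) * real (Suc k))"
        using K(1) by (intro mult_left_mono) auto
      moreover have "2 \<le> 2 * real (Suc k)"
        by simp
      ultimately have "16 * K * V + 2
          \<le> 16 * K * ((real (d + 1) * (real N)\<^sup>2 + 1) * real (Suc k)) + 2 * real (Suc k)"
        by (rule add_mono)
      then show ?thesis
        by (simp only: distrib_right mult.assoc)
    qed
    finally show ?thesis .
  qed
  \<comment> \<open>Cauchy-Schwarz on the box; squaring the half yields the factor 4 in the
    statement.\<close>
  have "(\<bar>S\<bar> / 2)\<^sup>2 \<le> (\<Sum>w\<in>A \<inter> B. g w)\<^sup>2"
    using power_mono[OF half, of 2] by simp
  also have "\<dots> \<le> (\<Sum>w\<in>A \<inter> B. (g w)\<^sup>2) * real (card (A \<inter> B))"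
    by (rule sum_squared_le_sum_of_squares)
  also have "\<dots> \<le> l2sq g * ((16 * K * (real (d + 1) * (real N)\<^sup>2 + 1) + 2) * real (Suc k))"
  proof (rule mult_mono[OF _ card])
    have "l2sq g = (\<Sum>w\<in>A. (g w)\<^sup>2)"
      unfolding l2sq_def A_def by (rule Sum_any_finsupp) (use finA in \<open>auto simp: A_def\<close>)
    then show "(\<Sum>w\<in>A \<inter> B. (g w)\<^sup>2) \<le> l2sq g"
      using finA by (auto intro: sum_mono2)
    show "0 \<le> l2sq g"
      unfolding g_def by (intro l2sq_nonneg finsupp_avg_pow fin)
  qed simp
  finally show ?thesis
    unfolding S_def g_def by (simp add: power_divide algebra_simps)
qed

text \<open>Summing bounds of order 1 / (k + 1) gives a harmonic number, and the constant does not
  depend on \<open>t\<close>; this logarithmic growth is what rules out reconstruction at \<beta> =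
  1.\<close>

lemma sum_l2sq_avg_pow_lower:
  assumes "d \<le> 2"
    and "{w. f w \<noteq> 0} \<subseteq> layer d t \<inter> window d N a"
    and "0 < K" "Sum_any (\<lambda>w. \<bar>f w\<bar>) \<le> K * \<bar>Sum_any f\<bar>"
  shows "(Sum_any f)\<^sup>2 * ln (real t + 1)
      \<le> 4 * (16 * K * (real (d + 1) * (real N)\<^sup>2 + 1) + 2) * (\<Sum>k<t. l2sq ((avg d ^^ k) f))"
proof -
  define D where "D = 4 * (16 * K * (real (d + 1) * (real N)\<^sup>2 + 1) + 2)"
  have "(Sum_any f)\<^sup>2 * ln (real t + 1) \<le> (Sum_any f)\<^sup>2 * (\<Sum>k<t. 1 / real (Suc k))"
  proof (rule mult_left_mono)
    have "(\<Sum>k<t. 1 / real (Suc k)) = harm t"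
      by (simp only: harm_altdef inverse_eq_divide)
    then show "ln (real t + 1) \<le> (\<Sum>k<t. 1 / real (Suc k))"
      using ln_le_harm[of t] by simp
  qed simp
  also have "\<dots> \<le> (\<Sum>k<t. D * l2sq ((avg d ^^ k) f))"
    unfolding sum_distrib_left
  proof (rule sum_mono)
    fix k assume "k \<in> {..<t}"
    then have "(Sum_any f)\<^sup>2 \<le> D * real (Suc k) * l2sq ((avg d ^^ k) f)"
      unfolding D_def by (intro l2sq_avg_pow_lower[OF assms]) simp
    then show "(Sum_any f)\<^sup>2 * (1 / real (Suc k)) \<le> D * l2sq ((avg d ^^ k) f)"
      by (simp add: field_simps)
  qed
  finally show ?thesis
    by (simp add: D_def sum_distrib_left)
qed

section \<open>Impossibility of local reconstruction\<close>

context broadcast_HS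
begin

text \<open>The single coefficient function is cut into one finitely supported \<open>f t\<close>
  per layer, so that the probabilistic statement becomes one about this sequence alone.\<close>

lemma recon_statistic:
  assumes "recon_with_width d N M X0 X"
  shows "\<exists>a f. (\<forall>t. {w. f t w \<noteq> 0} \<subseteq> layer d t \<inter> window d N (a t)) \<and>
    \<not> (\<lambda>t. \<beta> ^ t * Sum_any (f t) / sqrt (stat_variance t (f t))) \<longlonglongrightarrow> 0"
proof -
  from assms obtain a c where *: "\<not> (\<lambda>t. correlation M (\<lambda>\<omega>. \<Sum>u\<in>layer d t \<inter> window d N (a t). c u * X u \<omega>) X0) \<longlonglongrightarrow> 0"
    unfolding recon_with_width_def Let_def by blast
  define f where "f t w = (if w \<in> layer d t \<inter> window d N (a t) then c w else 0)" for t w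
  have supp: "{w. f t w \<noteq> 0} \<subseteq> layer d t \<inter> window d N (a t)" for t
    by (auto simp: f_def)
  have "(\<lambda>\<omega>. \<Sum>u\<in>layer d t \<inter> window d N (a t). c u * X u \<omega>) = linear_stat (f t)" for t
  proof
    fix \<omega>
    have "linear_stat (f t) \<omega> = (\<Sum>u\<in>layer d t \<inter> window d N (a t). f t u * X u \<omega>)"
      unfolding linear_stat_def using window_card(1) supp[of t]
      by (intro Sum_any.expand_superset) auto
    then show "(\<Sum>u\<in>layer d t \<inter> window d N (a t). c u * X u \<omega>) = linear_stat (f t) \<omega>"
      by (simp add: f_def)
  qed
  moreover have "correlation M (linear_stat (f t)) X0 = \<beta> ^ t * Sum_any (f t) / sqrt (stat_variance t (f t))" for t
  proof (rule correlation_linear_stat)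
    show "finsupp (f t)"
      using supp finsupp_window by blast
  qed (use supp in blast)
  ultimately have "\<not> (\<lambda>t. \<beta> ^ t * Sum_any (f t) / sqrt (stat_variance t (f t))) \<longlonglongrightarrow> 0"
    using * by simp
  then show ?thesis
    using supp by blast
qed

text \<open>Keeps only the noise on the edges into the last layer, the term k = 0, which is present
  because t > 0.\<close>

lemma stat_variance_ge:
  assumes "\<alpha> > 0" "finsupp f" "t > 0"
  shows "\<alpha>\<^sup>2 * real (d + 1) * l2sq f \<le> stat_variance t f"
proof -
  have "\<beta> ^ (2 * 0) * l2sq ((avg d ^^ 0) f) \<le> (\<Sum>k<t. \<beta> ^ (2 * k) * l2sq ((avg d ^^ k) f))"
    using assms by (intro member_le_sum mult_nonneg_nonneg l2sq_nonneg finsupp_avg_pow) auto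
  then have "\<alpha>\<^sup>2 * real (d + 1) * l2sq f
      \<le> \<alpha>\<^sup>2 * real (d + 1) * (\<Sum>k<t. \<beta> ^ (2 * k) * l2sq ((avg d ^^ k) f))"
    by (intro mult_left_mono) auto
  moreover have "0 \<le> \<beta> ^ (2 * t) * (Sum_any f)\<^sup>2"
    using assms by simp
  ultimately show ?thesis
    unfolding stat_variance_def by linarith
qed

text \<open>The noise of the last layer alone bounds the total of the coefficients by a constant
  times the standard deviation, uniformly in t and in the window position, so the correlation is at
  most a constant times \<beta>^t.\<close>

lemma subcritical:
  assumes \<alpha>: "\<alpha> > 0" "\<beta> < 1"
  shows "\<not> local_reconstruction d M X0 X"
  unfolding local_reconstruction_def
proof
  assume "\<exists>N. recon_with_width d N M X0 X"
  then obtain N where "recon_with_width d N M X0 X" ..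
  from recon_statistic[OF this] obtain a f where supp: "\<And>t. {w. f t w \<noteq> 0} \<subseteq> layer d t \<inter> window d N (a t)"
    and no_lim: "\<not> (\<lambda>t. \<beta> ^ t * Sum_any (f t) / sqrt (stat_variance t (f t))) \<longlonglongrightarrow> 0"
    by blast
  define A where "A = \<alpha>\<^sup>2 * real (d + 1)"
  have A: "A > 0"
    using \<alpha> by (simp add: A_def)
  define K where "K = sqrt (real N ^ (d + 1) / A)"
  have bound: "norm (\<beta> ^ t * Sum_any (f t) / sqrt (stat_variance t (f t))) \<le> \<beta> ^ t * K" if "t > 0" for t
  proof -
    have win: "{w. f t w \<noteq> 0} \<subseteq> window d N (a t)"
      using supp by blast
    note fin = finsupp_window[OF win]
    have "(Sum_any (f t))\<^sup>2 \<le> (Sum_any (\<lambda>w. \<bar>f t w\<bar>))\<^sup>2"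
      using power_mono[OF Sum_any_abs_ge[OF fin], of 2] by simp
    also have "\<dots> \<le> real N ^ (d + 1) * l2sq (f t)"
      by (rule Sum_any_abs_squared_le[OF win])
    also have "\<dots> = real N ^ (d + 1) / A * (A * l2sq (f t))"
      using A by simp
    also have "\<dots> \<le> real N ^ (d + 1) / A * stat_variance t (f t)"
      using stat_variance_ge[OF \<alpha>(1) fin that] A by (intro mult_left_mono) (auto simp: A_def)
    finally have "sqrt ((Sum_any (f t))\<^sup>2) \<le> sqrt (real N ^ (d + 1) / A * stat_variance t (f t))"
      by (rule real_sqrt_le_mono)
    then have le: "\<bar>Sum_any (f t)\<bar> \<le> K * sqrt (stat_variance t (f t))"
      by (simp only: real_sqrt_abs real_sqrt_mult K_def)
    have nonneg: "0 \<le> stat_variance t (f t)"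
      using stat_variance_ge[OF \<alpha>(1) fin that] l2sq_nonneg[OF fin] A unfolding A_def[symmetric]
      by (meson mult_nonneg_nonneg less_imp_le order.trans)
    have "\<bar>Sum_any (f t)\<bar> / sqrt (stat_variance t (f t)) \<le> K"
    \<comment> \<open>If the variance is 0, the quotient is 0 by the convention for division and the
      bound still holds.\<close>
    proof (cases "stat_variance t (f t) = 0")
      case False
      then have "sqrt (stat_variance t (f t)) > 0"
        using nonneg by simp
      then show ?thesis
        using le by (simp add: pos_divide_le_eq)
    qed (use A in \<open>simp add: K_def\<close>)
    then have "\<beta> ^ t * (\<bar>Sum_any (f t)\<bar> / sqrt (stat_variance t (f t))) \<le> \<beta> ^ t * K"
      using \<alpha>(1) by (intro mult_left_mono) auto
    then show ?thesis
      using \<alpha>(1) nonneg by (simp add: abs_mult)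
  qed
  have "(\<lambda>t. \<beta> ^ t * K) \<longlonglongrightarrow> 0"
    using \<alpha> by (intro tendsto_mult_left_zero LIMSEQ_power_zero) simp
  then have "(\<lambda>t. \<beta> ^ t * Sum_any (f t) / sqrt (stat_variance t (f t))) \<longlonglongrightarrow> 0"
    by (rule Lim_null_comparison[rotated]) (use bound in \<open>auto simp: eventually_at_top_dense\<close>)
  with no_lim show False
    by contradiction
qed

text \<open>A correlation of size at least \<epsilon> bounds the accumulated noise \<open>Q\<close>
  by a constant times \<open>S\<^sup>2\<close>. The same bound on its k = 0 term makes the l1 norm
  comparable to \<open>S\<close>, which forces \<open>Q\<close> to be at least of order
  \<open>S\<^sup>2 * ln (real t + 1)\<close>. The two collide once the logarithm exceeds
  \<open>D / (A * \<epsilon>\<^sup>2)\<close>.\<close>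

lemma critical_low_dimension:
  assumes d: "d \<le> 2" and \<alpha>: "\<alpha> > 0" "\<beta> = 1"
  shows "\<not> local_reconstruction d M X0 X"
  unfolding local_reconstruction_def
proof
  assume "\<exists>N. recon_with_width d N M X0 X"
  then obtain N where "recon_with_width d N M X0 X" ..
  from recon_statistic[OF this] obtain a f where supp: "\<And>t. {w. f t w \<noteq> 0} \<subseteq> layer d t \<inter> window d N (a t)"
    and no_lim: "\<not> (\<lambda>t. \<beta> ^ t * Sum_any (f t) / sqrt (stat_variance t (f t))) \<longlonglongrightarrow> 0"
    by blast
  define A where "A = \<alpha>\<^sup>2 * real (d + 1)"
  have A: "A > 0"
    using \<alpha> by (simp add: A_def)
  have "(\<lambda>t. Sum_any (f t) / sqrt (stat_variance t (f t))) \<longlonglongrightarrow> 0"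
  proof (rule LIMSEQ_I)
    fix \<epsilon> :: real assume \<epsilon>: "\<epsilon> > 0"
    \<comment> \<open>The square root is the ratio of l1 norm to total that a correlation \<epsilon>
      allows; adding 1 keeps \<open>K\<close> positive when \<open>N = 0\<close>. Neither
      \<open>K\<close> nor \<open>D\<close> depends on \<open>t\<close>, so the threshold can be
      fixed beforehand.\<close>
    define K where "K = sqrt (real N ^ (d + 1) / (A * \<epsilon>\<^sup>2)) + 1"
    define D where "D = 4 * (16 * K * (real (d + 1) * (real N)\<^sup>2 + 1) + 2)"
    have K: "K > 0"
      using A by (simp add: K_def add_nonneg_pos)
    have D: "D > 0"
      using K by (simp add: D_def add_nonneg_pos)
    have "filterlim (\<lambda>t. ln (real t + 1)) at_top sequentially"
      by real_asymp
    then have "\<forall>\<^sub>F t in sequentially. ln (real t + 1) > D / (A * \<epsilon>\<^sup>2)"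
      by (simp add: filterlim_at_top_dense)
    then obtain t0 where t0: "\<And>t. t \<ge> t0 \<Longrightarrow> ln (real t + 1) > D / (A * \<epsilon>\<^sup>2)"
      by (auto simp: eventually_sequentially)
    \<comment> \<open>Starting at \<open>Suc t0\<close> makes \<open>t\<close> positive, so that the
      term k = 0 belongs to \<open>Q\<close>.\<close>
    have "norm (Sum_any (f t) / sqrt (stat_variance t (f t)) - 0) < \<epsilon>" if t: "t \<ge> Suc t0" for t
    proof (rule ccontr)
      define S where "S = Sum_any (f t)"
      define Q where "Q = (\<Sum>k<t. l2sq ((avg d ^^ k) (f t)))"
      have win: "{w. f t w \<noteq> 0} \<subseteq> window d N (a t)"
        using supp by blast
      note fin = finsupp_window[OF win]
      have var: "stat_variance t (f t) = S\<^sup>2 + A * Q"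
        using \<alpha>(2) by (simp add: stat_variance_def S_def A_def Q_def)
      have Q: "0 \<le> Q"
        unfolding Q_def by (intro sum_nonneg l2sq_nonneg finsupp_avg_pow fin)
      assume "\<not> norm (Sum_any (f t) / sqrt (stat_variance t (f t)) - 0) < \<epsilon>"
      then have ge: "\<epsilon> \<le> \<bar>S\<bar> / sqrt (S\<^sup>2 + A * Q)"
        using Q A unfolding var S_def[symmetric] by simp
      then have S: "S \<noteq> 0"
        using \<epsilon> by auto
      have pos: "S\<^sup>2 + A * Q > 0"
        using S A Q by (simp add: add_pos_nonneg)
      have "\<epsilon>\<^sup>2 \<le> (\<bar>S\<bar> / sqrt (S\<^sup>2 + A * Q))\<^sup>2"
        using ge \<epsilon> by (intro power_mono) auto
      also have "\<dots> = S\<^sup>2 / (S\<^sup>2 + A * Q)"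
        using pos by (simp add: power_divide)
      finally have "\<epsilon>\<^sup>2 * (S\<^sup>2 + A * Q) \<le> S\<^sup>2"
        using pos by (simp add: pos_le_divide_eq)
      moreover have "A * \<epsilon>\<^sup>2 * Q \<le> \<epsilon>\<^sup>2 * (S\<^sup>2 + A * Q)"
        by (simp add: algebra_simps)
      ultimately have "A * \<epsilon>\<^sup>2 * Q \<le> S\<^sup>2"
        by linarith
      then have QS: "Q \<le> S\<^sup>2 / (A * \<epsilon>\<^sup>2)"
        using A \<epsilon> by (simp add: pos_le_divide_eq mult.commute)
      have "l2sq ((avg d ^^ 0) (f t)) \<le> Q"
        unfolding Q_def using t by (intro member_le_sum l2sq_nonneg finsupp_avg_pow fin) auto
      then have l2: "l2sq (f t) \<le> S\<^sup>2 / (A * \<epsilon>\<^sup>2)"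
        using QS by simp
      have "(Sum_any (\<lambda>w. \<bar>f t w\<bar>))\<^sup>2 \<le> real N ^ (d + 1) * l2sq (f t)"
        by (rule Sum_any_abs_squared_le[OF win])
      also have "\<dots> \<le> real N ^ (d + 1) * (S\<^sup>2 / (A * \<epsilon>\<^sup>2))"
        by (intro mult_left_mono l2) simp
      finally have "sqrt ((Sum_any (\<lambda>w. \<bar>f t w\<bar>))\<^sup>2) \<le> sqrt (real N ^ (d + 1) / (A * \<epsilon>\<^sup>2) * S\<^sup>2)"
        by (intro real_sqrt_le_mono) simp
      then have "Sum_any (\<lambda>w. \<bar>f t w\<bar>) \<le> sqrt (real N ^ (d + 1) / (A * \<epsilon>\<^sup>2)) * \<bar>S\<bar>"
        unfolding real_sqrt_mult real_sqrt_abs by linarith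
      also have "\<dots> \<le> K * \<bar>S\<bar>"
        by (intro mult_right_mono) (auto simp: K_def)
      finally have "S\<^sup>2 * ln (real t + 1) \<le> D * Q"
        unfolding S_def D_def Q_def by (intro sum_l2sq_avg_pow_lower[OF d supp K])
      also have "\<dots> \<le> D * (S\<^sup>2 / (A * \<epsilon>\<^sup>2))"
        using D by (intro mult_left_mono QS) simp
      finally have "S\<^sup>2 * ln (real t + 1) \<le> S\<^sup>2 * (D / (A * \<epsilon>\<^sup>2))"
        by (simp add: mult.commute)
      then have "ln (real t + 1) \<le> D / (A * \<epsilon>\<^sup>2)"
        by (rule mult_left_le_imp_le) (use S in simp)
      with t0[of t] t show False
        by simp
    qed
    then show "\<exists>no. \<forall>t\<ge>no. norm (Sum_any (f t) / sqrt (stat_variance t (f t)) - 0) < \<epsilon>"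
      by blast
  qed
  with no_lim \<alpha>(2) show False
    by simp
qed

section \<open>Reconstruction from one vertex per layer\<close>

definition axis_point :: "nat \<Rightarrow> pt" where
  "axis_point t = (\<lambda>j. if j = 0 then int t else 0)"

lemma axis_point_layer: "axis_point t \<in> layer d s \<longleftrightarrow> s = t"
proof -
  have "coord_sum d (axis_point t) = int t"
    by (simp add: coord_sum_def axis_point_def)
  then show ?thesis
    by (auto simp: layer_def HS_def axis_point_def)
qed

lemma layer_window_axis_point: "layer d t \<inter> window d 1 (axis_point t) = {axis_point t}"
proof -
  have "w = axis_point t" if "w \<in> layer d t" "w \<in> window d 1 (axis_point t)" for w
  proof
    fix j show "w j = axis_point t j"
      using that by (cases "j \<le> d") (auto simp: window_def layer_def HS_def axis_point_def dest!: spec[of _ j])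
  qed
  moreover have "axis_point t \<in> layer d t"
    by (simp add: axis_point_layer)
  moreover from this have "axis_point t \<in> window d 1 (axis_point t)"
    by (simp add: window_def layer_def)
  ultimately show ?thesis
    by blast
qed

text \<open>A point mass has total 1, so the variance is at most 1 + C times the squared covariance
  with the root, and the correlation stays above 1 / sqrt (1 + C). The axis is just a concrete
  choice of vertices: the norm bounds fed into this lemma are uniform in the position.\<close>

lemma single_vertex_reconstruction_if_bounded:
  assumes \<alpha>: "\<alpha> > 0" and C: "0 \<le> C"
    and le: "\<And>t. \<alpha>\<^sup>2 * real (d + 1) * (\<Sum>k<t. \<beta> ^ (2 * k) * l2sq ((avg d ^^ k) (delta (axis_point t)))) \<le> C * \<beta> ^ (2 * t)"
  shows "single_vertex_reconstruction d M X0 X"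
  unfolding single_vertex_reconstruction_def recon_with_width_def Let_def
proof (intro exI conjI allI ballI impI)
  \<comment> \<open>One coefficient function has to serve all layers; the axis meets each layer in a
    single point.\<close>
  let ?c = "\<lambda>u. if u \<in> range axis_point then 1 else 0 :: real"
  let ?\<zeta> = "\<lambda>t \<omega>. \<Sum>u\<in>layer d t \<inter> window d 1 (axis_point t). ?c u * X u \<omega>"
  let ?v = "\<lambda>t. delta (axis_point t)"
  have \<beta>: "\<beta> > 0"
    using \<alpha> by simp
  show "u \<in> window d 1 (axis_point t)" if "u \<in> layer d t" "?c u \<noteq> 0" for t u
  proof -
    have "u = axis_point t"
      using that by (auto simp: axis_point_layer split: if_splits)
    then show ?thesis
      using layer_window_axis_point[of t] by blast
  qed
  have \<zeta>: "?\<zeta> t \<omega> = linear_stat (?v t) \<omega>" for t \<omega>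
    unfolding layer_window_axis_point linear_stat_def
    by (subst Sum_any.expand_superset[of "{axis_point t}"]) (auto simp: delta_def)
  have supp: "{w. ?v t w \<noteq> 0} \<subseteq> layer d t" for t
    by (auto simp: delta_def axis_point_layer)
  note fin = finsupp_delta
  have lower: "\<beta> ^ (2 * t) \<le> stat_variance t (?v t)" for t
    unfolding stat_variance_def using \<beta>
    by (auto simp: Sum_any_delta intro!: mult_nonneg_nonneg sum_nonneg l2sq_nonneg finsupp_avg_pow fin)
  then have pos: "0 < stat_variance t (?v t)" for t
    using \<beta> by (meson less_le_trans zero_less_power)
  show "variance (?\<zeta> t) > 0" for t
    unfolding \<zeta> variance_linear_stat[OF fin supp] by (rule pos)
  have corr: "1 / sqrt (1 + C) \<le> correlation M (?\<zeta> t) X0" for t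
  proof -
    have "stat_variance t (?v t) \<le> (\<beta> ^ t)\<^sup>2 * (1 + C)"
      using le[of t] by (simp add: stat_variance_def Sum_any_delta power_mult[symmetric] algebra_simps)
    then have "sqrt (stat_variance t (?v t)) \<le> sqrt ((\<beta> ^ t)\<^sup>2 * (1 + C))"
      by (rule real_sqrt_le_mono)
    then have "sqrt (stat_variance t (?v t)) \<le> \<beta> ^ t * sqrt (1 + C)"
      using \<beta> unfolding real_sqrt_mult real_sqrt_abs by simp
    then have "\<beta> ^ t / (\<beta> ^ t * sqrt (1 + C)) \<le> \<beta> ^ t / sqrt (stat_variance t (?v t))"
      using \<beta> \<alpha> pos C by (intro divide_left_mono mult_pos_pos zero_less_power) auto
    moreover have "\<beta> ^ t / (\<beta> ^ t * sqrt (1 + C)) = 1 / sqrt (1 + C)"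
      by (rule nonzero_divide_mult_cancel_left) (use \<beta> in force)
    ultimately show ?thesis
      unfolding \<zeta> correlation_linear_stat[OF fin supp] by (simp add: Sum_any_delta)
  qed
  show "\<not> (\<lambda>t. correlation M (?\<zeta> t) X0) \<longlonglongrightarrow> 0"
  proof
    assume "(\<lambda>t. correlation M (?\<zeta> t) X0) \<longlonglongrightarrow> 0"
    then have "1 / sqrt (1 + C) \<le> 0"
      by (rule LIMSEQ_le_const) (use corr in blast)
    then show False
      using C by simp
  qed
qed

text \<open>Even the trivial bound 1 on the norms suffices: the geometric sum is of the order of its
  last term, that is of \<beta>^(2 t), the size of the signal.\<close>

lemma supercritical:
  assumes \<alpha>: "\<alpha> > 0" "\<beta> > 1"
  shows "single_vertex_reconstruction d M X0 X"
proof (rule single_vertex_reconstruction_if_bounded)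
  have sq: "\<beta>\<^sup>2 > 1"
    using \<alpha>(2) by (rule one_less_power) simp
  let ?C = "\<alpha>\<^sup>2 * real (d + 1) / (\<beta>\<^sup>2 - 1)"
  show "0 \<le> ?C"
    using sq by simp
  show "\<alpha>\<^sup>2 * real (d + 1) * (\<Sum>k<t. \<beta> ^ (2 * k) * l2sq ((avg d ^^ k) (delta (axis_point t)))) \<le> ?C * \<beta> ^ (2 * t)" for t
  proof -
    have "(\<Sum>k<t. \<beta> ^ (2 * k) * l2sq ((avg d ^^ k) (delta (axis_point t)))) \<le> (\<Sum>k<t. \<beta> ^ (2 * k) * 1)"
      using \<alpha> by (intro sum_mono mult_left_mono l2sq_avg_pow_delta_le_1) auto
    also have "\<dots> = (\<Sum>k<t. (\<beta>\<^sup>2) ^ k)"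
      by (simp only: power_mult mult_1_right)
    also have "\<dots> = ((\<beta>\<^sup>2) ^ t - 1) / (\<beta>\<^sup>2 - 1)"
      using sq by (intro geometric_sum) simp
    also have "\<dots> \<le> \<beta> ^ (2 * t) / (\<beta>\<^sup>2 - 1)"
      using sq unfolding power_mult by (intro divide_right_mono) auto
    finally have "\<alpha>\<^sup>2 * real (d + 1) * (\<Sum>k<t. \<beta> ^ (2 * k) * l2sq ((avg d ^^ k) (delta (axis_point t))))
        \<le> \<alpha>\<^sup>2 * real (d + 1) * (\<beta> ^ (2 * t) / (\<beta>\<^sup>2 - 1))"
      by (intro mult_left_mono) auto
    then show ?thesis
      by simp
  qed
qed fact

lemma critical_high_dimension:
  assumes d: "d \<ge> 3" and \<alpha>: "\<alpha> > 0" "\<beta> = 1"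
  shows "single_vertex_reconstruction d M X0 X"
proof -
  obtain C where C: "\<And>v t. (\<Sum>k<t. l2sq ((avg d ^^ k) (delta v))) \<le> C"
    using sum_l2sq_avg_pow_delta_bounded[OF d] by blast
  from C[of 0 0] have "0 \<le> C"
    by simp
  show ?thesis
  proof (rule single_vertex_reconstruction_if_bounded)
    show "0 \<le> \<alpha>\<^sup>2 * real (d + 1) * C"
      using \<open>0 \<le> C\<close> by simp
    show "\<alpha>\<^sup>2 * real (d + 1) * (\<Sum>k<t. \<beta> ^ (2 * k) * l2sq ((avg d ^^ k) (delta (axis_point t))))
        \<le> \<alpha>\<^sup>2 * real (d + 1) * C * \<beta> ^ (2 * t)" for t
      unfolding \<alpha>(2) power_one mult_1 mult_1_right by (intro mult_left_mono C) simp
  qed fact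
qed

end

theorem mainTheorem4:
  fixes d :: nat and \<alpha> :: real and M :: "'a measure" and X0 :: "'a \<Rightarrow> real"
    and W :: "pt \<times> nat \<Rightarrow> 'a \<Rightarrow> real" and X :: "pt \<Rightarrow> 'a \<Rightarrow> real"
  assumes "\<alpha> > 0"
    and "gaussian_broadcast_HS d \<alpha> M X0 W X"
  shows "(\<alpha> > 1 / real (d + 1) \<longrightarrow> single_vertex_reconstruction d M X0 X)
       \<and> (\<alpha> < 1 / real (d + 1) \<longrightarrow> \<not> local_reconstruction d M X0 X)
       \<and> (\<alpha> = 1 / real (d + 1) \<longrightarrow>
            (d \<ge> 3 \<longrightarrow> single_vertex_reconstruction d M X0 X)
          \<and> (d \<le> 2 \<longrightarrow> \<not> local_reconstruction d M X0 X))"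
proof -
  interpret prob_space M
    using assms(2) by (simp add: gaussian_broadcast_HS_def)
  interpret broadcast_HS M d \<alpha> X0 W X
    by unfold_locales fact
  have "\<alpha> > 1 / real (d + 1) \<longleftrightarrow> \<beta> > 1" "\<alpha> < 1 / real (d + 1) \<longleftrightarrow> \<beta> < 1" "\<alpha> = 1 / real (d + 1) \<longleftrightarrow> \<beta> = 1"
    by (simp_all add: field_simps)
  then show ?thesis
    using supercritical subcritical critical_high_dimension critical_low_dimension assms(1) by blast
qed

end
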